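(* Let $\Omega\subseteq\mathbb R^N$ be an open set with bounded inner radius $R:=\sup_{x\in\Omega}\operatorname{dist}(x,\partial\Omega)<\infty$. Let $K\in L^\infty(B_1)$ be a translation invariant kernel ($K(x,y)=K(y)$) with $\lambda\le K\le\Lambda$ on $B_1$, and assume $L_K$ is $1$-regular with constant $\Lambda$. Let $u\in L^\infty(B_1(\Omega))\cap C^{Dini}_{loc}(\Omega)$ with $\|L_Ku\|^{(1)}_{\mathcal L^1(\Omega)}<\infty$. Then there exists $\alpha=\alpha(\lambda,\Lambda,N)\in(0,1)$ such that $u\in\mathcal L^{1+\alpha}_{loc}(\Omega)$ and $$\|u\|^{(0)}_{\mathcal L^{1+\alpha}(\Omega)}\le C\big(\|u\|_{L^\infty(B_1(\Omega))}+\|L_Ku\|^{(1)}_{\mathcal L^1(\Omega)}\big)$$ for some $C=C(\lambda,\Lambda,N,R)>0$.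
   Context: $B_1(\Omega):=\bigcup_{x\in\Omega}B_1(x)$. $C^{Dini}_{loc}(\Omega)$: functions that on every closed ball in $\Omega$ admit a modulus of continuity $\omega$ with $\int_0^1\omega(\rho)\rho^{-1}d\rho<\infty$. $L_Ku(x):=\int_{B_1(x)}\frac{u(x)-u(y)}{|y-x|^N}K(y-x)\,dy$. $\ell(\rho):=|\ln(\min\{\rho,1/10\})|^{-1}$ ($\rho>0$), $\ell(0):=0$. $L_K$ is $\alpha$-regular with constant $\Lambda_0$ if, with $K$ extended by zero outside $B_1$, for all $z,w$ with $z\pm\frac w2\in\Omega$: $\int_{\mathbb R^N\setminus B_{2|w|}}\Big|\frac{K(\xi+\frac w2)}{|\xi+\frac w2|^N}-\frac{K(\xi-\frac w2)}{|\xi-\frac w2|^N}\Big|\ell(|\xi|)\,d\xi\le\Lambda_0\ell^\alpha(|w|)$. $d(x):=\operatorname{dist}(x,\partial\Omega)$, $d(x,y):=\min(d(x),d(y))$; $[u]_{\mathcal L^\alpha(U)}:=\sup_{x\ne y\in U}\frac{|u(x)-u(y)|}{\ell^\alpha(|x-y|)}$, $[u]^{(\beta)}_{\mathcal L^\alpha(\Omega)}:=\sup_{x\neq y\in\Omega}\ell^{\alpha+\beta}(d(x,y))\frac{|u(x)-u(y)|}{\ell^\alpha(|x-y|)}$, $\|u\|^{(\beta)}_{\mathcal L^\alpha(\Omega)}:=\sup_{x\in\Omega}\ell^\beta(d(x))|u(x)|+[u]^{(\beta)}_{\mathcal L^\alpha(\Omega)}$. $\mathcal L^\alpha_{loc}(\Omega)$: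 continuous $u$ with $\|u\|_{L^\infty(B)}+[u]_{\mathcal L^\alpha(B)}<\infty$ for every ball $B$ with $\overline B\subseteq\Omega$.
   Formalization: The ellipticity bound is taken with λ > 0, which the statement leaves implicit and without which it fails (K = 0, u Dini but not in any L^{1+α}_loc); Ω is taken nonempty and not the whole space, so that R is well defined. *)

theory Defs
  imports "HOL-Analysis.Analysis" "HOL-Probability.Essential_Supremum"
begin

definition ell :: "real \<Rightarrow> real" where
  "ell \<rho> = (if \<rho> > 0 then 1 / \<bar>ln (min \<rho> (1/10))\<bar> else 0)"

definition B1 :: "'a::euclidean_space set \<Rightarrow> 'a set" where
  "B1 \<Omega> = (\<Union>x\<in>\<Omega>. ball x 1)"

definition dB :: "'a::euclidean_space set \<Rightarrow> 'a \<Rightarrow> real" where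
  "dB \<Omega> x = infdist x (frontier \<Omega>)"

definition dB2 :: "'a::euclidean_space set \<Rightarrow> 'a \<Rightarrow> 'a \<Rightarrow> real" where
  "dB2 \<Omega> x y = min (dB \<Omega> x) (dB \<Omega> y)"

definition LK :: "('a::euclidean_space \<Rightarrow> real) \<Rightarrow> ('a \<Rightarrow> real) \<Rightarrow> 'a \<Rightarrow> real" where
  "LK K u x = set_lebesgue_integral lebesgue (ball x 1)
      (\<lambda>y. (u x - u y) / norm (y - x) ^ DIM('a) * K (y - x))"

definition Kext :: "('a::euclidean_space \<Rightarrow> real) \<Rightarrow> 'a \<Rightarrow> real" where
  "Kext K y = (if y \<in> ball 0 1 then K y else 0)"

definition regular :: "real \<Rightarrow> real \<Rightarrow> 'a::euclidean_space set \<Rightarrow> ('a \<Rightarrow> real) \<Rightarrow> bool" where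
  "regular \<alpha> \<Lambda>0 \<Omega> K \<longleftrightarrow>
     (\<forall>z w. z + w /\<^sub>R 2 \<in> \<Omega> \<longrightarrow> z - w /\<^sub>R 2 \<in> \<Omega> \<longrightarrow>
        set_nn_integral lebesgue (- ball 0 (2 * norm w))
          (\<lambda>\<xi>. ennreal (\<bar>Kext K (\<xi> + w /\<^sub>R 2) / norm (\<xi> + w /\<^sub>R 2) ^ DIM('a)
                        - Kext K (\<xi> - w /\<^sub>R 2) / norm (\<xi> - w /\<^sub>R 2) ^ DIM('a)\<bar>
                        * ell (norm \<xi>)))
        \<le> ennreal (\<Lambda>0 * ell (norm w) powr \<alpha>))"

definition modulus :: "(real \<Rightarrow> real) \<Rightarrow> bool" where
  "modulus \<omega> \<longleftrightarrow> \<omega> 0 = 0 \<and> (\<forall>r\<ge>0. \<omega> r \<ge> 0) \<and> mono_on {0..} \<omega>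
      \<and> (\<omega> \<longlongrightarrow> 0) (at_right 0)"

definition Dini_loc :: "'a::euclidean_space set \<Rightarrow> ('a \<Rightarrow> real) \<Rightarrow> bool" where
  "Dini_loc \<Omega> u \<longleftrightarrow>
     (\<forall>c r. cball c r \<subseteq> \<Omega> \<longrightarrow>
        (\<exists>\<omega>. modulus \<omega>
           \<and> (\<forall>x\<in>cball c r. \<forall>y\<in>cball c r. \<bar>u x - u y\<bar> \<le> \<omega> (dist x y))
           \<and> set_nn_integral lebesgue {0<..1} (\<lambda>\<rho>. ennreal (\<omega> \<rho> / \<rho>)) < \<infinity>))"

definition lsemi :: "real \<Rightarrow> 'a::euclidean_space set \<Rightarrow> ('a \<Rightarrow> real) \<Rightarrow> ennreal" where
  "lsemi \<alpha> U u = (SUP p\<in>{(x,y). x \<in> U \<and> y \<in> U \<and> x \<noteq> y}.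
      ennreal (\<bar>u (fst p) - u (snd p)\<bar> / ell (dist (fst p) (snd p)) powr \<alpha>))"

definition Lloc :: "real \<Rightarrow> 'a::euclidean_space set \<Rightarrow> ('a \<Rightarrow> real) \<Rightarrow> bool" where
  "Lloc \<alpha> \<Omega> u \<longleftrightarrow> continuous_on \<Omega> u \<and>
     (\<forall>c r. 0 < r \<longrightarrow> cball c r \<subseteq> \<Omega> \<longrightarrow>
        (SUP x\<in>ball c r. ennreal \<bar>u x\<bar>) + lsemi \<alpha> (ball c r) u < \<infinity>)"

definition wsemi :: "real \<Rightarrow> real \<Rightarrow> 'a::euclidean_space set \<Rightarrow> ('a \<Rightarrow> real) \<Rightarrow> ennreal" where
  "wsemi \<beta> \<alpha> \<Omega> u = (SUP p\<in>{(x,y). x \<in> \<Omega> \<and> y \<in> \<Omega> \<and> x \<noteq> y}.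
      ennreal (ell (dB2 \<Omega> (fst p) (snd p)) powr (\<alpha> + \<beta>) * \<bar>u (fst p) - u (snd p)\<bar>
               / ell (dist (fst p) (snd p)) powr \<alpha>))"

definition wnorm :: "real \<Rightarrow> real \<Rightarrow> 'a::euclidean_space set \<Rightarrow> ('a \<Rightarrow> real) \<Rightarrow> ennreal" where
  "wnorm \<beta> \<alpha> \<Omega> u = (SUP x\<in>\<Omega>. ennreal (ell (dB \<Omega> x) powr \<beta> * \<bar>u x\<bar>)) + wsemi \<beta> \<alpha> \<Omega> u"

definition Linf :: "'a::euclidean_space set \<Rightarrow> ('a \<Rightarrow> real) \<Rightarrow> ereal" where
  "Linf S u = esssup (lebesgue_on S) (\<lambda>x. ereal \<bar>u x\<bar>)"

end

theory Submission
  imports Defs "HOL-Probability.Probability_Measure"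
begin

text \<open>
  The exponent \<open>\<alpha> = 1/2\<close> works. Fix an increment \<open>w\<close> of
  length \<open>r\<close>, a point \<open>x0\<close> at distance \<open>d\<close> from the boundary, and put \<open>v x = u (x + w) - u x\<close>. As the
  kernel is translation invariant, \<open>L v\<close> is the increment of \<open>L u\<close>. Let \<open>xb\<close> maximise \<open>v\<close> minus a cone of
  height \<open>H \<ge> v\<close> and radius \<open>\<rho> = d / 4\<close>. In \<open>L v xb\<close> the part near \<open>xb\<close> has a nonnegative integrand, up to the
  slope of the cone, hence decreases if \<open>K\<close> is replaced there by a Lipschitz kernel of mass comparable
  to \<open>1 / ell r\<close>; integrated against that kernel, the translates of \<open>u\<close> cancel. This bounds
  \<open>v x0 / ell r\<close> by the increment of \<open>L u\<close>, \<open>H\<close>, and the far part of \<open>L v\<close>.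

  With \<open>H\<close> and the far part bounded through \<open>\<parallel>u\<parallel>\<close> alone, this gives \<open>\<bar>v x0\<bar> \<le> C * ell r / ell d\<close>. With this
  bound as the new \<open>H\<close>, and with the far part estimated by the regularity of the kernel, a second
  application gives \<open>\<bar>v x0\<bar> \<le> C * (ell r / ell d)\<^sup>2\<close>.
\<close>

section \<open>Radial integrals and translations\<close>

text \<open>Since \<open>K\<close> is merely bounded and measurable, its translates cannot be
  compared near the origin; the sign available at the maximum point is what allows a Lipschitz
  minorant to replace it there. Logarithmic coordinates t = 1 / ell r and D = 1 / ell d (r = exp(-t)
  and d = exp(-D) at small scales) turn the scale invariant mass of |z|^(-N) into lengths. The
  minorant is capped at radius a = r^\<theta> with \<theta> = 1/(2(N+1)): its Lipschitz constant, of
  order a^(-N-1), times the shift r leaves an error r^(1/2), while its mass is still comparable to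
  t. One application then reads t v <= C (F D^2/t + M/t + H + S), with S the far part. In the first
  round H has size M and S has size M D, which gives v <= C (M+F) D/t. In the second round both have
  size (M+F) D/t, so the data term F D^2/t sets the order and the quadratic bound results. If t is
  not large compared with D, the bound v <= 2M is enough. The power 2 of ell r / ell d yields every
  exponent between 0 and 2 by comparison with the sup bound, in particular 1 + 1/2.\<close>

lemma distributed_norm:
  "distributed (lborel :: 'a::euclidean_space measure) lborel norm
     (\<lambda>t. ennreal (if 0 < t then real DIM('a) * unit_ball_vol (real DIM('a)) * t ^ (DIM('a) - 1) else 0))"
  (is "distributed _ _ _ (\<lambda>t. ennreal (?f t))")
proof (rule distributedI_borel_atMost[where g = "\<lambda>a. if 0 \<le> a then unit_ball_vol (real DIM('a)) * a ^ DIM('a) else 0"])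
  let ?n = "DIM('a)" and ?V = "unit_ball_vol (real DIM('a))"
  fix a :: real
  show "(\<integral>\<^sup>+t. ennreal (?f t * indicator {..a} t) \<partial>lborel) =
    ennreal (if 0 \<le> a then ?V * a ^ ?n else 0)"
  proof (cases "0 \<le> a")
    case True
    have "(\<integral>\<^sup>+t. ennreal (?f t * indicator {..a} t) \<partial>lborel) =
      (\<integral>\<^sup>+t. ennreal (real ?n * ?V * t ^ (?n - 1)) * indicator {0..a} t \<partial>lborel)"
      by (rule nn_integral_cong_AE, use AE_lborel_singleton[of "0::real"] in eventually_elim)
        (auto simp: indicator_def)
    also have "\<dots> = ennreal (?V * a ^ ?n - ?V * 0 ^ ?n)"
    proof (rule nn_integral_FTC_Icc)
      fix t :: real assume t: "t \<in> {0..a}"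
      show "((\<lambda>t. ?V * t ^ ?n) has_real_derivative real ?n * ?V * t ^ (?n - 1)) (at t)"
        by (auto intro!: derivative_eq_intros)
      show "0 \<le> real ?n * ?V * t ^ (?n - 1)" using t by simp
    qed (use True in auto)
    finally show ?thesis using True by simp
  next
    case False
    then have "(\<integral>\<^sup>+t. ennreal (?f t * indicator {..a} t) \<partial>lborel) = (\<integral>\<^sup>+t. 0 \<partial>(lborel::real measure))"
      by (intro nn_integral_cong) (auto simp: indicator_def)
    with False show ?thesis by simp
  qed
  \<comment> \<open>Polar coordinates for radial integrands need only the volume V a^N of a ball:
    its derivative in a is the density.\<close>
  have "{x \<in> space (lborel::'a measure). norm x \<le> a} = cball 0 a"
    by (auto simp: cball_def dist_norm)
  then show "emeasure (lborel::'a measure) {x \<in> space lborel. norm x \<le> a} =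
      ennreal (if 0 \<le> a then ?V * a ^ ?n else 0)"
    by (simp add: emeasure_cball)
qed (auto intro!: AE_I2)

lemma nn_integral_norm:
  fixes \<phi> :: "real \<Rightarrow> ennreal"
  assumes [measurable]: "\<phi> \<in> borel_measurable borel"
  shows "(\<integral>\<^sup>+z. \<phi> (norm z) \<partial>(lebesgue :: 'a::euclidean_space measure)) =
    ennreal (real DIM('a) * unit_ball_vol (real DIM('a))) *
      (\<integral>\<^sup>+t. \<phi> t * ennreal (t ^ (DIM('a) - 1)) * indicator {0<..} t \<partial>lborel)"
proof -
  have "(\<integral>\<^sup>+z. \<phi> (norm (z::'a)) \<partial>lebesgue) = (\<integral>\<^sup>+z. \<phi> (norm (z::'a)) \<partial>lborel)"
    by (rule nn_integral_completion)
  also have "\<dots> = (\<integral>\<^sup>+t. ennreal (if 0 < t then real DIM('a) * unit_ball_vol (real DIM('a)) * t ^ (DIM('a) - 1) else 0) * \<phi> t \<partial>lborel)"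
    by (rule distributed_nn_integral[OF distributed_norm, symmetric]) simp
  also have "\<dots> = (\<integral>\<^sup>+t. ennreal (real DIM('a) * unit_ball_vol (real DIM('a))) *
      (\<phi> t * ennreal (t ^ (DIM('a) - 1)) * indicator {0<..} t) \<partial>lborel)"
    by (intro nn_integral_cong) (auto simp: indicator_def ennreal_mult' mult_ac)
  finally show ?thesis
    by (subst (asm) nn_integral_cmult) simp_all
qed

text \<open>The factor |z|^(-N) cancels the Jacobian t^(N-1) up to 1/t, leaving the scale invariant
  measure dt/t. All logarithms below come from here.\<close>

lemma nn_integral_norm_kernel:
  fixes \<phi> :: "real \<Rightarrow> real"
  assumes [measurable]: "\<phi> \<in> borel_measurable borel"
  shows "(\<integral>\<^sup>+z. ennreal (\<phi> (norm z) / norm z ^ DIM('a)) \<partial>(lebesgue :: 'a::euclidean_space measure)) =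
    ennreal (real DIM('a) * unit_ball_vol (real DIM('a))) *
      (\<integral>\<^sup>+t. ennreal (\<phi> t / t) * indicator {0<..} t \<partial>lborel)"
proof -
  have *: "ennreal (\<phi> t / t ^ DIM('a)) * ennreal (t ^ (DIM('a) - 1)) = ennreal (\<phi> t / t)" if "0 < t" for t
  proof -
    have "DIM('a) = Suc (DIM('a) - 1)" by simp
    then have "t ^ DIM('a) = t * t ^ (DIM('a) - 1)" by (metis power_Suc)
    then show ?thesis using that by (simp add: ennreal_mult''[symmetric])
  qed
  have "(\<integral>\<^sup>+t. ennreal (\<phi> t / t ^ DIM('a)) * ennreal (t ^ (DIM('a) - 1)) * indicator {0<..} t \<partial>lborel) =
    (\<integral>\<^sup>+t. ennreal (\<phi> t / t) * indicator {0<..} t \<partial>lborel)"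
    using * by (intro nn_integral_cong) (simp add: indicator_def)
  then show ?thesis
    by (subst nn_integral_norm[where \<phi> = "\<lambda>t. ennreal (\<phi> t / t ^ DIM('a))"]) simp_all
qed

lemma nn_integral_annulus_kernel:
  fixes a b :: real
  assumes "0 < a" "a \<le> b"
  shows "(\<integral>\<^sup>+z. ennreal (indicator {a..<b} (norm z) / norm z ^ DIM('a)) \<partial>(lebesgue :: 'a::euclidean_space measure)) =
    ennreal (real DIM('a) * unit_ball_vol (real DIM('a)) * ln (b / a))"
proof -
  have "(\<integral>\<^sup>+t. ennreal (indicator {a..<b} t / t) * indicator {0<..} t \<partial>lborel) =
    (\<integral>\<^sup>+t. ennreal (1 / t) * indicator {a..b} t \<partial>lborel)"
    by (rule nn_integral_cong_AE, use AE_lborel_singleton[of b] in eventually_elim)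
      (use assms in \<open>auto simp: indicator_def\<close>)
  also have "\<dots> = ennreal (ln b - ln a)"
    using assms by (intro nn_integral_FTC_Icc) (auto intro!: derivative_eq_intros)
  finally show ?thesis
    using assms by (subst nn_integral_norm_kernel) (simp_all add: ln_div ennreal_mult'' mult_ac)
qed

text \<open>This is the price of the slope of the cone in the maximum principle. It does not depend
  on \<rho>, so the cone contributes a bounded term and no logarithm.\<close>

lemma nn_integral_ball_linear_kernel:
  fixes \<rho> :: real
  assumes "0 < \<rho>"
  shows "(\<integral>\<^sup>+z. ennreal (indicator {..<\<rho>} (norm z) * (norm z / \<rho>) / norm z ^ DIM('a)) \<partial>(lebesgue :: 'a::euclidean_space measure)) =
    ennreal (real DIM('a) * unit_ball_vol (real DIM('a)))"
proof -
  have "(\<integral>\<^sup>+t. ennreal (indicator {..<\<rho>} t * (t / \<rho>) / t) * indicator {0<..} t \<partial>lborel) =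
    (\<integral>\<^sup>+t. ennreal (1 / \<rho>) * indicator {0..\<rho>} t \<partial>lborel)"
    by (rule nn_integral_cong_AE,
        use AE_lborel_singleton[of \<rho>] AE_lborel_singleton[of "0::real"] in eventually_elim)
      (use assms in \<open>auto simp: indicator_def\<close>)
  also have "\<dots> = 1"
    using assms by (simp add: nn_integral_cmult ennreal_mult''[symmetric])
  finally show ?thesis
    using assms by (subst nn_integral_norm_kernel[where \<phi> = "\<lambda>t. indicator {..<\<rho>} t * (t / \<rho>)"]) simp_all
qed

section \<open>Translation invariance of the completed Lebesgue measure\<close>

lemma
  fixes t :: "'a::euclidean_space"
  shows measurable_lebesgue_plus: "(+) t \<in> lebesgue \<rightarrow>\<^sub>M lebesgue"
    and distr_lebesgue_plus: "distr lebesgue lebesgue ((+) t) = lebesgue"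
proof -
  show "(+) t \<in> lebesgue \<rightarrow>\<^sub>M lebesgue"
    using lebesgue_affine_measurable[of "\<lambda>_. 1" t] by (simp add: euclidean_representation)
  show "distr lebesgue lebesgue ((+) t) = lebesgue"
    using lebesgue_affine_euclidean[of "\<lambda>_. 1" t] by (simp add: euclidean_representation density_1)
qed

lemma measurable_lebesgue_plus_comp:
  fixes g :: "'a::euclidean_space \<Rightarrow> 'b::topological_space"
  assumes "g \<in> borel_measurable lebesgue"
  shows "(\<lambda>z. g (t + z)) \<in> borel_measurable lebesgue"
  using measurable_comp[OF measurable_lebesgue_plus assms] by (simp add: o_def)

lemma lebesgue_integral_plus:
  fixes g :: "'a::euclidean_space \<Rightarrow> real"
  assumes "g \<in> borel_measurable lebesgue"
  shows "(LINT z|lebesgue. g (t + z)) = (LINT z|lebesgue. g z)"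
  using integral_distr[OF measurable_lebesgue_plus assms, of t] by (simp add: distr_lebesgue_plus)

lemma lebesgue_integrable_plus:
  fixes g :: "'a::euclidean_space \<Rightarrow> real"
  assumes "integrable lebesgue g"
  shows "integrable lebesgue (\<lambda>z. g (t + z))"
  using integrable_distr[OF measurable_lebesgue_plus, of t g] assms by (simp add: distr_lebesgue_plus)

section \<open>A Lipschitz truncation of the kernel\<close>

lemma integrable_nonneg_nn_integral:
  fixes f :: "'a \<Rightarrow> real"
  assumes "f \<in> borel_measurable M" "\<And>x. 0 \<le> f x" "(\<integral>\<^sup>+x. ennreal (f x) \<partial>M) = ennreal c" "0 \<le> c"
  shows "integrable M f" and "integral\<^sup>L M f = c"
  using assms by (auto intro: integrableI_nonneg simp: integral_eq_nn_integral)

lemma borel_measurable_lebesgueI: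
  assumes "f \<in> borel_measurable borel" shows "f \<in> borel_measurable lebesgue"
  using assms by (intro measurable_completion) simp

lemma annulus_kernel_integral:
  fixes a b :: real
  assumes "0 < a" "a \<le> b"
  defines "f \<equiv> \<lambda>z::'a::euclidean_space. indicator {a..<b} (norm z) / norm z ^ DIM('a)"
  shows "integrable lebesgue f"
    and "integral\<^sup>L lebesgue f = real DIM('a) * unit_ball_vol (real DIM('a)) * ln (b / a)"
proof -
  have "f \<in> borel_measurable lebesgue" unfolding f_def by (rule borel_measurable_lebesgueI) simp
  moreover have "0 \<le> f z" for z by (simp add: f_def)
  ultimately show "integrable lebesgue f"
    "integral\<^sup>L lebesgue f = real DIM('a) * unit_ball_vol (real DIM('a)) * ln (b / a)"
    using nn_integral_annulus_kernel[OF assms(1,2), where 'a='a] assms(1,2)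
    by (auto simp: f_def intro!: integrable_nonneg_nn_integral)
qed

lemma ball_linear_kernel_integral:
  fixes \<rho> :: real
  assumes "0 < \<rho>"
  defines "f \<equiv> \<lambda>z::'a::euclidean_space. indicator {..<\<rho>} (norm z) * (norm z / \<rho>) / norm z ^ DIM('a)"
  shows "integrable lebesgue f"
    and "integral\<^sup>L lebesgue f = real DIM('a) * unit_ball_vol (real DIM('a))"
proof -
  have "f \<in> borel_measurable lebesgue" unfolding f_def by (rule borel_measurable_lebesgueI) simp
  moreover have "0 \<le> f z" for z using assms by (simp add: f_def)
  ultimately show "integrable lebesgue f"
    "integral\<^sup>L lebesgue f = real DIM('a) * unit_ball_vol (real DIM('a))"
    using nn_integral_ball_linear_kernel[OF assms(1), where 'a='a]
    by (auto simp: f_def intro!: integrable_nonneg_nn_integral)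
qed

lemma ball_indicator_integral:
  fixes \<rho> :: real
  assumes "0 \<le> \<rho>"
  shows "integrable lebesgue (\<lambda>z::'a::euclidean_space. indicator {..<\<rho>} (norm z) :: real)"
    and "(LINT z::'a|lebesgue. indicator {..<\<rho>} (norm z)) = unit_ball_vol (real DIM('a)) * \<rho> ^ DIM('a)"
proof -
  have eq: "(\<lambda>z::'a. indicator {..<\<rho>} (norm z) :: real) = indicator (ball 0 \<rho>)"
    by (auto simp: indicator_def fun_eq_iff)
  show "integrable lebesgue (\<lambda>z::'a. indicator {..<\<rho>} (norm z) :: real)"
    unfolding eq using emeasure_ball[OF assms, of "0::'a"]
    by (simp add: integrable_indicator_iff)
  show "(LINT z::'a|lebesgue. indicator {..<\<rho>} (norm z)) = unit_ball_vol (real DIM('a)) * \<rho> ^ DIM('a)"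
    unfolding eq using content_ball[OF assms, of "0::'a"] by simp
qed

lemma inverse_power_diff_le:
  fixes a s t :: real
  assumes "0 < a" "a \<le> s" "a \<le> t"
  shows "\<bar>1 / s ^ n - 1 / t ^ n\<bar> \<le> real n / a ^ Suc n * \<bar>s - t\<bar>"
proof -
  have *: "\<bar>1 / s ^ n - 1 / t ^ n\<bar> \<le> real n / a ^ Suc n * (t - s)" if st: "a \<le> s" "s < t" for s t
  proof -
    have "\<exists>z. s < z \<and> z < t \<and> (1 / t ^ n) - (1 / s ^ n) = (t - s) * (- (real n * z ^ (n - 1)) / (z ^ n * z ^ n))"
    proof (rule MVT2[OF st(2)])
      fix z assume "s \<le> z" "z \<le> t"
      then have "0 < z" using st assms by simp
      then show "((\<lambda>t. 1 / t ^ n) has_real_derivative - (real n * z ^ (n - 1)) / (z ^ n * z ^ n)) (at z)"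
        by (auto intro!: derivative_eq_intros)
    qed
    then obtain z where z: "s < z" "z < t"
      "1 / t ^ n - 1 / s ^ n = (t - s) * (- (real n * z ^ (n - 1)) / (z ^ n * z ^ n))" by blast
    have z0: "0 < z" using z st assms by simp
    have "real n * z ^ (n - 1) / (z ^ n * z ^ n) = real n / z ^ Suc n"
    proof (cases n)
      case (Suc m)
      then show ?thesis using z0 by (simp add: field_simps)
    qed simp
    also have "\<dots> \<le> real n / a ^ Suc n"
      using z st assms by (intro divide_left_mono power_mono mult_pos_pos zero_less_power) auto
    finally have "(t - s) * (real n * z ^ (n - 1) / (z ^ n * z ^ n)) \<le> (t - s) * (real n / a ^ Suc n)"
      using st by (intro mult_left_mono) auto
    moreover have "0 \<le> (t - s) * (real n * z ^ (n - 1) / (z ^ n * z ^ n))"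
      using st z0 by simp
    ultimately show ?thesis using z(3) by (simp add: mult.commute)
  qed
  show ?thesis
    using *[of s t] *[of t s] assms by (cases s t rule: linorder_cases) (auto simp: abs_minus_commute)
qed

text \<open>A Lipschitz minorant of |z|^(-N): the cap at radius a removes the singularity, and
  subtracting \<rho>^(-N) before taking the positive part makes it vanish continuously at |z| =
  \<rho>.\<close>

definition trunc_ker :: "real \<Rightarrow> real \<Rightarrow> 'a::euclidean_space \<Rightarrow> real" where
  "trunc_ker a \<rho> z = max 0 (1 / max (norm z) a ^ DIM('a) - 1 / \<rho> ^ DIM('a))"

lemma trunc_ker_nonneg: "0 \<le> trunc_ker a \<rho> z"
  by (simp add: trunc_ker_def)

lemma trunc_ker_le:
  fixes z :: "'a::euclidean_space"
  assumes "0 < a" "0 < \<rho>" "z \<noteq> 0"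
  shows "trunc_ker a \<rho> z \<le> 1 / norm z ^ DIM('a)"
proof -
  have "1 / max (norm z) a ^ DIM('a) \<le> 1 / norm z ^ DIM('a)"
    using assms by (intro divide_left_mono power_mono mult_pos_pos zero_less_power) auto
  moreover have "0 \<le> 1 / \<rho> ^ DIM('a)" using assms by simp
  ultimately have "1 / max (norm z) a ^ DIM('a) - 1 / \<rho> ^ DIM('a) \<le> 1 / norm z ^ DIM('a)" by linarith
  then show ?thesis unfolding trunc_ker_def by simp
qed

lemma trunc_ker_eq_0:
  fixes z :: "'a::euclidean_space"
  assumes "0 < \<rho>" "\<rho> \<le> norm z"
  shows "trunc_ker a \<rho> z = 0"
proof -
  have "1 / max (norm z) a ^ DIM('a) \<le> 1 / \<rho> ^ DIM('a)"
    using assms by (intro divide_left_mono power_mono mult_pos_pos zero_less_power) auto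
  then show ?thesis unfolding trunc_ker_def by simp
qed

text \<open>Positive part, cap and norm are all 1-Lipschitz, so the constant is the largest slope of
  s^(-N) on s >= a.\<close>

lemma trunc_ker_lipschitz:
  fixes z z' :: "'a::euclidean_space"
  assumes "0 < a"
  shows "\<bar>trunc_ker a \<rho> z - trunc_ker a \<rho> z'\<bar> \<le> real DIM('a) / a ^ Suc DIM('a) * norm (z - z')"
proof -
  have "\<bar>trunc_ker a \<rho> z - trunc_ker a \<rho> z'\<bar> \<le>
      \<bar>1 / max (norm z) a ^ DIM('a) - 1 / max (norm z') a ^ DIM('a)\<bar>"
    unfolding trunc_ker_def by linarith
  also have "\<dots> \<le> real DIM('a) / a ^ Suc DIM('a) * \<bar>max (norm z) a - max (norm z') a\<bar>"
    using assms by (intro inverse_power_diff_le) auto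
  also have "\<dots> \<le> real DIM('a) / a ^ Suc DIM('a) * norm (z - z')"
  proof (intro mult_left_mono)
    show "\<bar>max (norm z) a - max (norm z') a\<bar> \<le> norm (z - z')"
      using norm_triangle_ineq3[of z z'] by linarith
  qed (use assms in simp)
  finally show ?thesis .
qed

lemma borel_measurable_trunc_ker: "trunc_ker a \<rho> \<in> borel_measurable lebesgue"
  unfolding trunc_ker_def by (rule borel_measurable_lebesgueI) simp

lemma integrable_trunc_ker_times:
  fixes g :: "'a::euclidean_space \<Rightarrow> real"
  assumes "0 < a" "0 < \<rho>" "g \<in> borel_measurable lebesgue" "\<And>z. \<bar>g z\<bar> \<le> B"
  shows "integrable lebesgue (\<lambda>z. g z * trunc_ker a \<rho> z)"
proof (rule Bochner_Integration.integrable_bound)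
  show "integrable lebesgue (\<lambda>z::'a. B * (1 / a ^ DIM('a)) * indicator {..<\<rho>} (norm z))"
    using ball_indicator_integral(1)[of \<rho>, where 'a='a] assms by (intro integrable_mult_right) auto
  show "(\<lambda>z. g z * trunc_ker a \<rho> z) \<in> borel_measurable lebesgue"
    using assms borel_measurable_trunc_ker by (intro borel_measurable_times) auto
  have B: "0 \<le> B" using assms(4)[of 0] by linarith
  show "AE z in lebesgue. norm (g z * trunc_ker a \<rho> z) \<le> norm (B * (1 / a ^ DIM('a)) * indicator {..<\<rho>} (norm z))"
  proof (intro AE_I2)
    fix z :: 'a
    show "norm (g z * trunc_ker a \<rho> z) \<le> norm (B * (1 / a ^ DIM('a)) * indicator {..<\<rho>} (norm z))"
    proof (cases "norm z < \<rho>")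
      case True
      have "1 / max (norm z) a ^ DIM('a) \<le> 1 / a ^ DIM('a)"
        using assms by (intro divide_left_mono power_mono mult_pos_pos zero_less_power) auto
      moreover have "0 \<le> 1 / \<rho> ^ DIM('a)" using assms by simp
      ultimately have "1 / max (norm z) a ^ DIM('a) - 1 / \<rho> ^ DIM('a) \<le> 1 / a ^ DIM('a)" by linarith
      then have "trunc_ker a \<rho> z \<le> 1 / a ^ DIM('a)"
        unfolding trunc_ker_def using assms(1) by simp
      then have "\<bar>g z\<bar> * trunc_ker a \<rho> z \<le> B * (1 / a ^ DIM('a))"
        using assms(4)[of z] B trunc_ker_nonneg[of a \<rho> z] by (intro mult_mono) auto
      then show ?thesis using True trunc_ker_nonneg[of a \<rho> z] B assms(1) by (simp add: abs_mult)
    next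
      case False
      then show ?thesis using trunc_ker_eq_0[of \<rho> z a] assms by simp
    qed
  qed
qed

text \<open>The annulus between a and \<rho> carries the logarithm. Subtracting \<rho>^(-N) over the
  ball of radius \<rho> costs exactly the unit ball volume V <= N V, whence the -1.\<close>

lemma trunc_ker_integral_ge:
  assumes "0 < a" "a < \<rho>"
  shows "real DIM('a) * unit_ball_vol (real DIM('a)) * (ln (\<rho> / a) - 1)
    \<le> (LINT z::'a::euclidean_space|lebesgue. trunc_ker a \<rho> z)"
proof -
  let ?V = "unit_ball_vol (real DIM('a))"
  have V: "?V \<le> real DIM('a) * ?V"
    using DIM_positive[where 'a='a] by (simp add: Suc_leI)
  have "real DIM('a) * ?V * (ln (\<rho> / a) - 1) \<le> real DIM('a) * ?V * ln (\<rho> / a) - 1 / \<rho> ^ DIM('a) * (?V * \<rho> ^ DIM('a))"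
    using V assms by (simp add: algebra_simps)
  also have "\<dots> = (LINT z::'a|lebesgue. indicator {a..<\<rho>} (norm z) / norm z ^ DIM('a)
       - 1 / \<rho> ^ DIM('a) * indicator {..<\<rho>} (norm z))"
    using assms annulus_kernel_integral[of a \<rho>, where 'a='a] ball_indicator_integral[of \<rho>, where 'a='a]
    by (subst Bochner_Integration.integral_diff) simp_all
  also have "\<dots> \<le> (LINT z::'a|lebesgue. trunc_ker a \<rho> z)"
  proof (rule integral_mono)
    show "integrable lebesgue (\<lambda>z::'a. indicator {a..<\<rho>} (norm z) / norm z ^ DIM('a)
       - 1 / \<rho> ^ DIM('a) * indicator {..<\<rho>} (norm z))"
      using assms annulus_kernel_integral[of a \<rho>, where 'a='a] ball_indicator_integral[of \<rho>, where 'a='a]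
      by (intro Bochner_Integration.integrable_diff integrable_mult_right) simp_all
    show "integrable lebesgue (trunc_ker a \<rho> :: 'a \<Rightarrow> real)"
      using integrable_trunc_ker_times[of a \<rho> "\<lambda>_. 1" 1] assms by simp
    fix z :: 'a
    \<comment> \<open>For |z| < a the left side is just -\<rho>^(-N), so the mass of the cap is
      discarded.\<close>
    show "indicator {a..<\<rho>} (norm z) / norm z ^ DIM('a) - 1 / \<rho> ^ DIM('a) * indicator {..<\<rho>} (norm z)
       \<le> trunc_ker a \<rho> z"
      using assms by (auto simp: trunc_ker_def indicator_def max_def)
  qed
  finally show ?thesis .
qed

text \<open>A change of variables moves the shift by w from \<open>U\<close> onto the kernel, where
  the Lipschitz bound applies; no regularity of \<open>U\<close> beyond boundedness enters.\<close>

lemma trunc_ker_translation: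
  fixes U :: "'a::euclidean_space \<Rightarrow> real"
  assumes "0 < a" "0 < \<rho>" "\<rho> + norm w \<le> 1"
    and [measurable]: "U \<in> borel_measurable lebesgue" and U: "\<And>x. \<bar>U x\<bar> \<le> M"
  shows "\<bar>LINT z|lebesgue. (U (x + w + z) - U (x + z)) * trunc_ker a \<rho> z\<bar>
    \<le> M * (real DIM('a) * unit_ball_vol (real DIM('a))) * norm w / a ^ Suc DIM('a)"
proof -
  let ?q = "trunc_ker a \<rho> :: 'a \<Rightarrow> real"
  let ?C = "real DIM('a) / a ^ Suc DIM('a) * norm w"
  have M: "0 \<le> M" using U[of 0] by linarith
  have meas: "(\<lambda>z. U (y + z)) \<in> borel_measurable lebesgue" for y
    by (rule measurable_lebesgue_plus_comp) simp
  have i1: "integrable lebesgue (\<lambda>z. U (y + z) * ?q z)" for y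
    using meas U assms by (intro integrable_trunc_ker_times) auto
  have i2: "integrable lebesgue (\<lambda>z. U (x + z) * ?q (-w + z))"
    using lebesgue_integrable_plus[OF i1[of "x + w"], of "-w"] by (simp add: add.assoc)
  have "(LINT z|lebesgue. (U (x + w + z) - U (x + z)) * ?q z)
     = (LINT z|lebesgue. U (x + w + z) * ?q z) - (LINT z|lebesgue. U (x + z) * ?q z)"
    using i1 by (simp add: left_diff_distrib)
  also have "(LINT z|lebesgue. U (x + w + z) * ?q z) = (LINT z|lebesgue. U (x + z) * ?q (-w + z))"
    using lebesgue_integral_plus[of "\<lambda>z. U (x + w + z) * ?q z" "-w"] i1[of "x + w"]
    by (simp add: add.assoc)
  finally have eq: "(LINT z|lebesgue. (U (x + w + z) - U (x + z)) * ?q z)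
     = (LINT z|lebesgue. U (x + z) * (?q (-w + z) - ?q z))"
    using i1 i2 by (simp add: right_diff_distrib)
  have "\<bar>LINT z|lebesgue. U (x + z) * (?q (-w + z) - ?q z)\<bar>
      \<le> (LINT z|lebesgue. \<bar>U (x + z) * (?q (-w + z) - ?q z)\<bar>)"
    using integral_norm_bound[of lebesgue "\<lambda>z. U (x + z) * (?q (-w + z) - ?q z)"] by simp
  \<comment> \<open>Both copies of the kernel vanish for |z| >= 1 because \<rho> + |w| <= 1, so
    integrating over the unit ball suffices.\<close>
  also have "\<dots> \<le> (LINT z::'a|lebesgue. M * ?C * indicator {..<1} (norm z))"
  proof (rule integral_mono)
    show "integrable lebesgue (\<lambda>z. \<bar>U (x + z) * (?q (-w + z) - ?q z)\<bar>)"
      using i1 i2 by (simp add: right_diff_distrib)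
    show "integrable lebesgue (\<lambda>z::'a. M * ?C * indicator {..<1} (norm z))"
      using ball_indicator_integral(1)[of 1, where 'a='a] by (intro integrable_mult_right) auto
    fix z :: 'a
    show "\<bar>U (x + z) * (?q (-w + z) - ?q z)\<bar> \<le> M * ?C * indicator {..<1} (norm z)"
    proof (cases "norm z < 1")
      case True
      have "\<bar>?q (-w + z) - ?q z\<bar> \<le> ?C"
        using trunc_ker_lipschitz[OF assms(1), of \<rho> "-w + z" z] by simp
      then have "\<bar>U (x + z)\<bar> * \<bar>?q (-w + z) - ?q z\<bar> \<le> M * ?C"
        using U M by (intro mult_mono) auto
      then show ?thesis using True by (simp add: abs_mult)
    next
      case False
      have "norm z - norm w \<le> norm (-w + z)" using norm_triangle_ineq2[of z w] by simp
      then have "?q (-w + z) = 0" "?q z = 0"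
        using False assms by (auto intro!: trunc_ker_eq_0 intro: order_trans[of _ "1 - norm w"] simp del: norm_ge_zero)
           (use norm_ge_zero[of w] in linarith)+
      then show ?thesis using False by simp
    qed
  qed
  also have "\<dots> = M * ?C * unit_ball_vol (real DIM('a))"
    using ball_indicator_integral(2)[of 1, where 'a='a] by simp
  finally show ?thesis unfolding eq by (simp add: mult_ac)
qed

section \<open>The maximum principle for increments\<close>

lemma ell_pos: "0 < \<rho> \<Longrightarrow> 0 < ell \<rho>"
  by (simp add: ell_def min_def)

lemma ell_nonneg: "0 \<le> ell \<rho>"
  by (cases "0 < \<rho>") (use ell_pos[of \<rho>] in simp, simp add: ell_def)

lemma ell_eq: "0 < \<rho> \<Longrightarrow> ell \<rho> = 1 / ln (1 / min \<rho> (1/10))"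
proof -
  assume "0 < \<rho>"
  then have "ln (min \<rho> (1/10)) < 0" by (simp add: min_def)
  then show ?thesis using \<open>0 < \<rho>\<close> by (simp add: ell_def ln_div)
qed

lemma ell_mono:
  assumes "\<rho> \<le> \<rho>'"
  shows "ell \<rho> \<le> ell \<rho>'"
proof (cases "0 < \<rho>")
  case True
  define p q where "p = min \<rho> (1/10)" and "q = min \<rho>' (1/10)"
  have pq: "0 < p" "p \<le> q" "q < 1" using True assms by (auto simp: p_def q_def)
  then have "ln p \<le> ln q" "ln q < 0" by simp_all
  then have "1 / \<bar>ln p\<bar> \<le> 1 / \<bar>ln q\<bar>"
    by (intro divide_left_mono mult_pos_pos) auto
  then show ?thesis
    using True assms by (simp add: ell_def p_def q_def)
next
  case False
  then have "ell \<rho> = 0" by (simp add: ell_def)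
  then show ?thesis using ell_nonneg[of \<rho>'] by simp
qed

text \<open>Here \<open>k\<close> stands for the whole kernel K(z)/|z|^N extended by zero, and
  \<open>\<sigma>\<close> is the surface measure of the unit sphere. Division by zero being 0, the
  two bounds force k 0 = 0.\<close>

locale log_kernel =
  fixes k :: "'a::euclidean_space \<Rightarrow> real" and lam Lam \<sigma> :: real
  assumes k_measurable [measurable]: "k \<in> borel_measurable lebesgue"
    and lam_pos: "0 < lam" and Lam_pos: "0 < Lam"
    and k_lower: "norm z < 1 \<Longrightarrow> lam / norm z ^ DIM('a) \<le> k z"
    and k_upper: "norm z < 1 \<Longrightarrow> k z \<le> Lam / norm z ^ DIM('a)"
    and k_zero: "1 \<le> norm z \<Longrightarrow> k z = 0"
    and \<sigma>_eq: "\<sigma> = real DIM('a) * unit_ball_vol (real DIM('a))"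
begin

lemma \<sigma>_pos: "0 < \<sigma>"
  by (simp add: \<sigma>_eq)

lemma k_nonneg: "0 \<le> k z"
proof (cases "norm z < 1")
  case True
  then show ?thesis using k_lower[of z] lam_pos by (intro order_trans[OF _ k_lower]) auto
qed (simp add: k_zero)

lemma k_far_le: "indicator {\<rho>..} (norm z) * k z \<le> Lam * (indicator {\<rho>..<1} (norm z) / norm z ^ DIM('a))"
  using k_upper[of z] k_zero[of z] by (auto simp: indicator_def not_less)

text \<open>The mass of \<open>k\<close> outside radius \<rho> is at most Lam \<sigma> ln(1/\<rho>).
  This bound uses nothing about \<open>g\<close> except its size and serves the estimate of order
  one.\<close>

lemma integrable_far:
  assumes "0 < \<rho>" "\<rho> \<le> 1" "g \<in> borel_measurable lebesgue" "\<And>z. \<bar>g z\<bar> \<le> B"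
  shows "integrable lebesgue (\<lambda>z. indicator {\<rho>..} (norm z) * g z * k z)"
    and "\<bar>LINT z|lebesgue. indicator {\<rho>..} (norm z) * g z * k z\<bar> \<le> B * Lam * \<sigma> * ln (1 / \<rho>)"
proof -
  have [measurable]: "(\<lambda>z::'a. indicator {\<rho>..} (norm z) :: real) \<in> borel_measurable lebesgue"
    by (rule borel_measurable_lebesgueI) simp
  have B: "0 \<le> B" using assms(4)[of 0] by linarith
  have bd: "\<bar>indicator {\<rho>..} (norm z) * g z * k z\<bar> \<le> B * Lam * (indicator {\<rho>..<1} (norm z) / norm z ^ DIM('a))" for z
  proof -
    have "\<bar>indicator {\<rho>..} (norm z) * g z * k z\<bar> = \<bar>g z\<bar> * (indicator {\<rho>..} (norm z) * k z)"
      using k_nonneg[of z] by (simp add: abs_mult mult_ac)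
    also have "\<dots> \<le> B * (Lam * (indicator {\<rho>..<1} (norm z) / norm z ^ DIM('a)))"
      by (rule mult_mono[OF assms(4) k_far_le B]) (simp add: k_nonneg)
    finally show ?thesis by (simp add: mult.assoc)
  qed
  have i: "integrable lebesgue (\<lambda>z::'a. B * Lam * (indicator {\<rho>..<1} (norm z) / norm z ^ DIM('a)))"
    using annulus_kernel_integral(1)[of \<rho> 1, where 'a='a] assms by (intro integrable_mult_right) auto
  show int: "integrable lebesgue (\<lambda>z. indicator {\<rho>..} (norm z) * g z * k z)"
    by (rule Bochner_Integration.integrable_bound[OF i])
      (use assms bd in \<open>auto intro!: AE_I2 order_trans[OF bd] borel_measurable_times simp del: times_divide_eq_right\<close>)
  have "\<bar>LINT z|lebesgue. indicator {\<rho>..} (norm z) * g z * k z\<bar>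
      \<le> (LINT z|lebesgue. \<bar>indicator {\<rho>..} (norm z) * g z * k z\<bar>)"
    by (rule integral_abs_bound)
  also have "\<dots> \<le> (LINT z::'a|lebesgue. B * Lam * (indicator {\<rho>..<1} (norm z) / norm z ^ DIM('a)))"
    using int i bd by (intro integral_mono) auto
  also have "\<dots> = B * Lam * \<sigma> * ln (1 / \<rho>)"
    using annulus_kernel_integral(2)[of \<rho> 1, where 'a='a] assms
    by (simp add: \<sigma>_eq del: times_divide_eq_right)
  finally show "\<bar>LINT z|lebesgue. indicator {\<rho>..} (norm z) * g z * k z\<bar> \<le> B * Lam * \<sigma> * ln (1 / \<rho>)" .
qed

text \<open>The four terms on the right are the four losses: the increment of L U, the failure of
  exact cancellation against the minorant, the slope of the cone, and the far part. \<open>H\<close>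
  is required on the ball of radius 2 \<rho> because the maximum point and the near displacement
  each lie within \<rho>.\<close>

lemma increment_max_principle:
  fixes U :: "'a \<Rightarrow> real" and x0 w :: 'a
  assumes [measurable]: "U \<in> borel_measurable lebesgue" and U_bd: "\<And>x. \<bar>U x\<bar> \<le> M"
    and a: "0 < a" "a < \<rho>" and \<rho>: "\<rho> + norm w \<le> 1"
    and cont: "continuous_on (cball x0 \<rho>) (\<lambda>x. U (x + w) - U x)"
    and int: "\<And>x. x \<in> ball x0 \<rho> \<Longrightarrow> integrable lebesgue (\<lambda>z. (U x - U (x + z)) * k z)"
      "\<And>x. x \<in> ball x0 \<rho> \<Longrightarrow> integrable lebesgue (\<lambda>z. (U (x + w) - U (x + w + z)) * k z)"
    and E: "\<And>x. x \<in> ball x0 \<rho> \<Longrightarrow> (LINT z|lebesgue. (U (x + w) - U (x + w + z)) * k z)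
        - (LINT z|lebesgue. (U x - U (x + z)) * k z) \<le> E"
    and H: "\<And>x. x \<in> ball x0 (2 * \<rho>) \<Longrightarrow> U (x + w) - U x \<le> H"
    and S: "\<And>x. x \<in> ball x0 \<rho> \<Longrightarrow>
        (LINT z|lebesgue. indicator {\<rho>..} (norm z) * (U (x + w + z) - U (x + z)) * k z) \<le> S"
    and pos: "0 < U (x0 + w) - U x0"
  shows "lam * \<sigma> * (ln (\<rho> / a) - 1) * (U (x0 + w) - U x0)
    \<le> E + lam * (M * \<sigma> * norm w / a ^ Suc DIM('a)) + Lam * H * \<sigma> + S"
proof -
  define v where "v x = U (x + w) - U x" for x
  \<comment> \<open>The cone has its vertex at x0 and reaches height H on the sphere of radius
    \<rho>. From there on v - \<psi> <= 0 as long as v <= H, whereas v - \<psi> is positive at x0;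
    so the maximum is interior.\<close>
  define \<psi> where "\<psi> x = H * min 1 (dist x x0 / \<rho>)" for x
  have \<rho>0: "0 < \<rho>" using a by simp
  have H0: "0 < H" using H[of x0] pos \<rho>0 by simp
  have "continuous_on (cball x0 \<rho>) (\<lambda>x. v x - \<psi> x)"
    unfolding v_def \<psi>_def by (rule continuous_on_diff[OF cont]) (intro continuous_intros, use \<rho>0 in auto)
  then obtain xb where xb: "xb \<in> cball x0 \<rho>" "\<And>x. x \<in> cball x0 \<rho> \<Longrightarrow> v x - \<psi> x \<le> v xb - \<psi> xb"
    using continuous_attains_sup[of "cball x0 \<rho>" "\<lambda>x. v x - \<psi> x"] \<rho>0 by auto
  have \<psi>0: "\<psi> x0 = 0" by (simp add: \<psi>_def)
  have \<psi>_nonneg: "0 \<le> \<psi> x" for x using H0 \<rho>0 by (simp add: \<psi>_def)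
  have \<psi>_out: "\<psi> x = H" if "\<rho> \<le> dist x x0" for x using that \<rho>0 by (simp add: \<psi>_def min_def)
  have max_pos: "v x0 \<le> v xb - \<psi> xb" using xb(2)[of x0] \<rho>0 \<psi>0 by simp
  have v0: "0 < v x0" using pos by (simp add: v_def)
  have xb_ball: "xb \<in> ball x0 \<rho>"
  proof (rule ccontr)
    assume "xb \<notin> ball x0 \<rho>"
    then have "\<psi> xb = H" by (intro \<psi>_out) (simp add: dist_commute)
    moreover have "v xb \<le> H" using xb(1) \<rho>0 H[of xb] by (simp add: v_def)
    ultimately show False using max_pos v0 by simp
  qed
  have glob: "v x - \<psi> x \<le> v xb - \<psi> xb" if "x \<in> ball x0 (2 * \<rho>)" for x
  proof (cases "x \<in> cball x0 \<rho>")
    case False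
    then have "\<psi> x = H" by (intro \<psi>_out) (simp add: dist_commute)
    moreover have "v x \<le> H" using that H[of x] by (simp add: v_def)
    ultimately show ?thesis using max_pos v0 by simp
  qed (use xb in auto)
  have \<psi>_lip: "\<psi> (xb + z) - \<psi> xb \<le> H * (norm z / \<rho>)" for z
  proof -
    have "dist (xb + z) x0 \<le> dist xb x0 + norm z"
      using dist_triangle[of "xb + z" x0 xb] by (simp add: dist_norm)
    then have "dist (xb + z) x0 / \<rho> \<le> dist xb x0 / \<rho> + norm z / \<rho>"
      using \<rho>0 by (simp add: divide_right_mono add_divide_distrib[symmetric])
    moreover have "0 \<le> norm z / \<rho>" using \<rho>0 by simp
    ultimately have "min 1 (dist (xb + z) x0 / \<rho>) - min 1 (dist xb x0 / \<rho>) \<le> norm z / \<rho>"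
      by linarith
    then show ?thesis using H0 unfolding \<psi>_def right_diff_distrib[symmetric] by (intro mult_left_mono) auto
  qed
  \<comment> \<open>Maximality of v - \<psi> at xb, with the Lipschitz bound of the cone added,
    provides the sign for exchanging kernels.\<close>
  have near: "0 \<le> v xb - v (xb + z) + H * (norm z / \<rho>)" if "norm z < \<rho>" for z
  proof -
    have "xb + z \<in> ball x0 (2 * \<rho>)"
      using xb_ball that dist_triangle[of x0 "xb + z" xb] by (simp add: dist_norm)
    then show ?thesis using glob[of "xb + z"] \<psi>_lip[of z] by simp
  qed

  let ?q = "trunc_ker a \<rho> :: 'a \<Rightarrow> real"
  define L where "L z = indicator {..<\<rho>} (norm z) * (norm z / \<rho>) / norm z ^ DIM('a)" for z :: 'a
  define T where "T z = indicator {\<rho>..} (norm z) * v (xb + z) * k z" for z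
  have v_meas: "(\<lambda>z. v (xb + z)) \<in> borel_measurable lebesgue"
    unfolding v_def add.assoc[symmetric] add.commute[of _ w]
    using measurable_lebesgue_plus_comp[of U "w + xb"] measurable_lebesgue_plus_comp[of U xb]
    by (simp add: add.assoc)
  have v_bd: "\<bar>v x\<bar> \<le> 2 * M" for x
    using U_bd[of x] U_bd[of "x + w"] unfolding v_def by linarith
  have G_eq: "(v xb - v (xb + z)) * k z = (U (xb + w) - U (xb + w + z)) * k z - (U xb - U (xb + z)) * k z" for z
    by (simp add: v_def algebra_simps)
  have G_int: "integrable lebesgue (\<lambda>z. (v xb - v (xb + z)) * k z)"
    unfolding G_eq using int xb_ball by (intro Bochner_Integration.integrable_diff) auto
  have "(LINT z|lebesgue. (v xb - v (xb + z)) * k z) \<le> E"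
    unfolding G_eq using E[OF xb_ball] int xb_ball by (subst Bochner_Integration.integral_diff) auto
  moreover have q_int: "integrable lebesgue (\<lambda>z. v xb * ?q z)" "integrable lebesgue (\<lambda>z. v (xb + z) * ?q z)"
    using integrable_trunc_ker_times[of a \<rho> "\<lambda>_. v xb" "2 * M"]
      integrable_trunc_ker_times[of a \<rho> "\<lambda>z. v (xb + z)" "2 * M"] a \<rho>0 v_bd v_meas by auto
  have L_int: "integrable lebesgue L" "integral\<^sup>L lebesgue L = \<sigma>"
    using ball_linear_kernel_integral[OF \<rho>0, where 'a='a] unfolding L_def[abs_def] \<sigma>_eq by auto
  have \<rho>1: "\<rho> \<le> 1" using \<rho> norm_ge_zero[of w] by linarith
  have T_int: "integrable lebesgue T"
    unfolding T_def[abs_def] using \<rho>0 \<rho>1 v_meas v_bd by (intro integrable_far) auto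
  have T_le: "integral\<^sup>L lebesgue T \<le> S"
    using S[OF xb_ball] unfolding T_def[abs_def] v_def by (simp add: add_ac)
  have R_int: "integrable lebesgue (\<lambda>z. lam * (v xb * ?q z - v (xb + z) * ?q z) - Lam * H * L z - T z)"
    using q_int L_int T_int by (intro Bochner_Integration.integrable_diff integrable_mult_right) auto
  \<comment> \<open>Pointwise comparison: for |z| < \<rho> the nonnegative factor permits lowering k
    to lam times the minorant, and the added slope is paid by the upper bound on k. For |z| >=
    \<rho> the term v xb * k z >= 0 is dropped, which leaves -T.\<close>
  have "(LINT z|lebesgue. lam * (v xb * ?q z - v (xb + z) * ?q z) - Lam * H * L z - T z)
      \<le> (LINT z|lebesgue. (v xb - v (xb + z)) * k z)"
  proof (rule integral_mono[OF R_int G_int])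
    fix z :: 'a
    show "lam * (v xb * ?q z - v (xb + z) * ?q z) - Lam * H * L z - T z \<le> (v xb - v (xb + z)) * k z"
    proof (cases "norm z < \<rho>")
      case True
      have Tz: "T z = 0" and Lz: "L z = norm z / \<rho> / norm z ^ DIM('a)"
        using True by (auto simp: T_def L_def)
      show ?thesis
      proof (cases "z = 0")
        \<comment> \<open>At the origin the increments vanish and \<open>L\<close> is 0 by the
          convention for division by zero.\<close>
        case True
        then show ?thesis using Tz by (simp add: L_def)
      next
        case False
        have z1: "norm z < 1" using True \<rho>1 by simp
        define g where "g = v xb - v (xb + z) + H * (norm z / \<rho>)"
        have g: "0 \<le> g" using near[OF True] by (simp add: g_def)
        have Hz: "0 \<le> H * (norm z / \<rho>)" using H0 \<rho>0 by simp
        have "lam * ?q z \<le> k z"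
          using mult_left_mono[OF trunc_ker_le[OF a(1) \<rho>0 False], of lam] k_lower[OF z1] lam_pos
          by simp
        then have 1: "lam * ?q z * g \<le> g * k z"
          using g by (simp add: mult.commute mult_left_mono)
        have 2: "H * (norm z / \<rho>) * k z \<le> Lam * H * L z"
          using mult_left_mono[OF k_upper[OF z1] Hz] unfolding Lz by (simp add: mult_ac)
        have 3: "lam * ?q z * (v xb - v (xb + z)) \<le> lam * ?q z * g"
          unfolding g_def using Hz lam_pos trunc_ker_nonneg[of a \<rho> z] by (intro mult_left_mono) auto
        have "lam * (v xb * ?q z - v (xb + z) * ?q z) = lam * ?q z * (v xb - v (xb + z))"
          by (simp add: algebra_simps)
        moreover have "(v xb - v (xb + z)) * k z = g * k z - H * (norm z / \<rho>) * k z"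
          by (simp add: g_def algebra_simps)
        ultimately show ?thesis using 1 2 3 Tz by linarith
      qed
    next
      case False
      then have "?q z = 0" "L z = 0" "T z = v (xb + z) * k z"
        using trunc_ker_eq_0[OF \<rho>0, of z a] by (auto simp: L_def T_def)
      moreover have "0 \<le> v xb * k z" using v0 max_pos \<psi>_nonneg[of xb] k_nonneg[of z] by simp
      ultimately show ?thesis by (simp add: left_diff_distrib)
    qed
  qed
  moreover have "(LINT z|lebesgue. lam * (v xb * ?q z - v (xb + z) * ?q z) - Lam * H * L z - T z) =
      lam * (v xb * (LINT z|lebesgue. ?q z) - (LINT z|lebesgue. v (xb + z) * ?q z)) - Lam * H * \<sigma> - integral\<^sup>L lebesgue T"
    using q_int L_int T_int by (simp add: Bochner_Integration.integral_diff)
  \<comment> \<open>v is a difference of two translates of U, so its integral against the minorant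
    is small and only v xb times the mass survives.\<close>
  moreover have "\<bar>LINT z|lebesgue. v (xb + z) * ?q z\<bar> \<le> M * \<sigma> * norm w / a ^ Suc DIM('a)"
    using trunc_ker_translation[OF a(1) \<rho>0 \<rho> assms(1) U_bd, of xb]
    unfolding v_def \<sigma>_eq by (simp add: add_ac)
  then have "lam * (LINT z|lebesgue. v (xb + z) * ?q z) \<le> lam * (M * \<sigma> * norm w / a ^ Suc DIM('a))"
    using lam_pos by (intro mult_left_mono) auto
  moreover have "\<sigma> * (ln (\<rho> / a) - 1) * v x0 \<le> v xb * (LINT z|lebesgue. ?q z)"
  proof -
    have "\<sigma> * (ln (\<rho> / a) - 1) * v x0 \<le> (LINT z|lebesgue. ?q z) * v x0"
      using trunc_ker_integral_ge[OF a, where 'a='a] v0 unfolding \<sigma>_eq by (intro mult_right_mono) auto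
    also have "\<dots> \<le> (LINT z|lebesgue. ?q z) * v xb"
      using max_pos \<psi>_nonneg[of xb] by (intro mult_left_mono integral_nonneg) (auto simp: trunc_ker_nonneg)
    finally show ?thesis by (simp add: mult.commute)
  qed
  then have "lam * (\<sigma> * (ln (\<rho> / a) - 1) * v x0) \<le> lam * (v xb * (LINT z|lebesgue. ?q z))"
    using lam_pos by (intro mult_left_mono) auto
  ultimately show ?thesis using T_le unfolding v_def by (simp add: algebra_simps)
qed

text \<open>In polar coordinates the Dini condition is precisely integrability of
  \<omega>(|z|)/|z|^N near the origin. Outside radius \<epsilon> boundedness and the finite mass of
  an annulus suffice.\<close>

lemma integrable_of_Dini:
  fixes U :: "'a \<Rightarrow> real"
  assumes [measurable]: "U \<in> borel_measurable lebesgue" and U_bd: "\<And>x. \<bar>U x\<bar> \<le> M"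
    and \<epsilon>: "0 < \<epsilon>" "\<epsilon> \<le> 1" and \<omega>: "modulus \<omega>"
    and U_\<omega>: "\<And>z. norm z < \<epsilon> \<Longrightarrow> \<bar>U x - U (x + z)\<bar> \<le> \<omega> (norm z)"
    and fin: "set_nn_integral lebesgue {0<..1} (\<lambda>t. ennreal (\<omega> t / t)) < \<infinity>"
  shows "integrable lebesgue (\<lambda>z. (U x - U (x + z)) * k z)"
proof -
  \<comment> \<open>A modulus is monotone only on the half line; inserting max 0 t makes it monotone
    everywhere, hence Borel.\<close>
  define \<phi> where "\<phi> t = indicator {..<\<epsilon>} t * \<omega> (max 0 t)" for t
  have "mono (\<lambda>t. \<omega> (max 0 t))"
    using \<omega> by (auto simp: modulus_def mono_on_def intro!: monoI)
  then have [measurable]: "(\<lambda>t. \<omega> (max 0 t)) \<in> borel_measurable borel"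
    by (rule borel_measurable_mono)
  have \<phi>m[measurable]: "\<phi> \<in> borel_measurable borel"
    unfolding \<phi>_def by measurable
  have \<phi>_nonneg: "0 \<le> \<phi> t" for t using \<omega> by (simp add: \<phi>_def modulus_def)
  have "(\<integral>\<^sup>+t. ennreal (\<phi> t / t) * indicator {0<..} t \<partial>lborel)
     \<le> (\<integral>\<^sup>+t. ennreal (\<omega> t / t) * indicator {0<..1} t \<partial>lborel)"
    using \<epsilon> by (intro nn_integral_mono) (auto simp: \<phi>_def indicator_def)
  also have "\<dots> < \<infinity>" using fin by (simp add: nn_integral_completion)
  finally have "(\<integral>\<^sup>+z. ennreal (\<phi> (norm z) / norm z ^ DIM('a)) \<partial>(lebesgue :: 'a measure)) < \<infinity>"
    by (subst nn_integral_norm_kernel) (auto simp: ennreal_mult_less_top)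
  then have i1: "integrable lebesgue (\<lambda>z::'a. \<phi> (norm z) / norm z ^ DIM('a))"
    by (intro integrableI_nonneg) (auto simp: \<phi>_nonneg intro!: borel_measurable_lebesgueI)
  have i2: "integrable lebesgue (\<lambda>z::'a. indicator {\<epsilon>..<1} (norm z) / norm z ^ DIM('a))"
    using annulus_kernel_integral(1)[of \<epsilon> 1, where 'a='a] \<epsilon> by auto
  have M: "0 \<le> M" using U_bd[of 0] by linarith
  have "integrable lebesgue (\<lambda>z::'a. Lam * (\<phi> (norm z) / norm z ^ DIM('a))
      + 2 * M * Lam * (indicator {\<epsilon>..<1} (norm z) / norm z ^ DIM('a)))"
    using i1 i2 by (intro Bochner_Integration.integrable_add integrable_mult_right) auto
  then show ?thesis
  proof (rule Bochner_Integration.integrable_bound)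
    have "(\<lambda>z. U (x + z)) \<in> borel_measurable lebesgue"
      by (rule measurable_lebesgue_plus_comp) simp
    then show "(\<lambda>z. (U x - U (x + z)) * k z) \<in> borel_measurable lebesgue" by measurable
    show "AE z in lebesgue. norm ((U x - U (x + z)) * k z) \<le> norm (Lam * (\<phi> (norm z) / norm z ^ DIM('a))
      + 2 * M * Lam * (indicator {\<epsilon>..<1} (norm z) / norm z ^ DIM('a)))"
    proof (rule AE_I2)
      fix z :: 'a
      have "\<bar>U x - U (x + z)\<bar> * k z \<le> Lam * (\<phi> (norm z) / norm z ^ DIM('a))
        + 2 * M * Lam * (indicator {\<epsilon>..<1} (norm z) / norm z ^ DIM('a))"
      proof (cases "norm z < \<epsilon>")
        case True
        then have "\<bar>U x - U (x + z)\<bar> * k z \<le> \<phi> (norm z) * (Lam / norm z ^ DIM('a))"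
          using U_\<omega>[OF True] k_upper[of z] k_nonneg[of z] \<epsilon> \<phi>_nonneg[of "norm z"]
          by (intro mult_mono) (auto simp: \<phi>_def)
        then show ?thesis using True by (simp add: mult_ac)
      next
        case False
        show ?thesis
        proof (cases "norm z < 1")
          case True
          have "\<bar>U x - U (x + z)\<bar> \<le> 2 * M" using U_bd[of x] U_bd[of "x + z"] by linarith
          then have "\<bar>U x - U (x + z)\<bar> * k z \<le> 2 * M * (Lam / norm z ^ DIM('a))"
            using k_upper[OF True] k_nonneg[of z] M by (intro mult_mono) auto
          then show ?thesis using True False by (simp add: \<phi>_def)
        qed (use False k_zero[of z] \<epsilon> in \<open>simp add: \<phi>_def\<close>)
      qed
      then show "norm ((U x - U (x + z)) * k z) \<le> norm (Lam * (\<phi> (norm z) / norm z ^ DIM('a))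
        + 2 * M * Lam * (indicator {\<epsilon>..<1} (norm z) / norm z ^ DIM('a)))"
        using k_nonneg[of z] by (simp add: abs_mult)
    qed
  qed
qed

end

section \<open>The far part under the regularity of the kernel\<close>

lemma power_diff_symmetric_le:
  fixes t :: real
  assumes "0 \<le> t" "t \<le> 1"
  shows "(1 + t) ^ n - (1 - t) ^ n \<le> real n * 2 ^ n * t"
proof (induction n)
  case (Suc n)
  have "(1 + t) ^ Suc n - (1 - t) ^ Suc n = (1 + t) * ((1 + t) ^ n - (1 - t) ^ n) + 2 * t * (1 - t) ^ n"
    by (simp add: algebra_simps)
  also have "\<dots> \<le> 2 * (real n * 2 ^ n * t) + 2 * t * 2 ^ n"
  proof (intro add_mono)
    have "(1 - t) ^ n \<le> (1 + t) ^ n" using assms by (intro power_mono) auto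
    then show "(1 + t) * ((1 + t) ^ n - (1 - t) ^ n) \<le> 2 * (real n * 2 ^ n * t)"
      using Suc.IH assms by (intro mult_mono) auto
    have "(1 - t) ^ n \<le> 2 ^ n" using assms by (intro power_mono) auto
    then show "2 * t * (1 - t) ^ n \<le> 2 * t * 2 ^ n" using assms by (intro mult_left_mono) auto
  qed
  also have "\<dots> = real (Suc n) * 2 ^ Suc n * t" by (simp add: algebra_simps)
  finally show ?case .
qed simp

context log_kernel
begin

text \<open>Half of the shift w goes to each side, so that U is evaluated at one common point and
  the kernel appears in the symmetric difference of the regularity condition. Removing the weight
  there costs 1 / ell (\<rho>/2); the sharp cut-off at \<rho> adds the volume of a thin
  shell.\<close>

lemma far_regular:
  fixes U :: "'a \<Rightarrow> real" and w :: 'a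
  assumes [measurable]: "U \<in> borel_measurable lebesgue" and U_bd: "\<And>x. \<bar>U x\<bar> \<le> M"
    and w: "0 < norm w" "4 * norm w \<le> \<rho>" and \<rho>: "\<rho> \<le> 1"
    and reg: "(\<integral>\<^sup>+\<xi>. ennreal (\<bar>k (\<xi> + w /\<^sub>R 2) - k (\<xi> - w /\<^sub>R 2)\<bar> * ell (norm \<xi>))
        * indicator (- ball 0 (2 * norm w)) \<xi> \<partial>lebesgue) \<le> ennreal (Lam * ell (norm w))"
  shows "\<bar>LINT z|lebesgue. indicator {\<rho>..} (norm z) * (U (x + w + z) - U (x + z)) * k z\<bar>
    \<le> M * (Lam * ell (norm w) / ell (\<rho> / 2) + Lam * \<sigma> * 2 ^ DIM('a) * (norm w / \<rho>))"
proof -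
  define k1 where "k1 z = indicator {\<rho>..} (norm z) * k z" for z
  define h where "h = w /\<^sub>R 2"
  define r where "r = norm w"
  have hh: "h + h = w" by (simp add: h_def scaleR_2[symmetric])
  have nh: "norm h = r / 2" by (simp add: h_def r_def)
  have r: "0 < r" "4 * r \<le> \<rho>" using w by (auto simp: r_def)
  then have \<rho>0: "0 < \<rho>" by linarith
  have M: "0 \<le> M" using U_bd[of 0] by linarith
  have U_meas: "(\<lambda>z. U (y + z)) \<in> borel_measurable lebesgue" for y
    by (rule measurable_lebesgue_plus_comp) simp
  have k_meas: "(\<lambda>z. k (y + z)) \<in> borel_measurable lebesgue" for y
    by (rule measurable_lebesgue_plus_comp) simp
  have i1: "integrable lebesgue (\<lambda>z. U (y + z) * k1 z)" for y
    using integrable_far(1)[OF \<rho>0 \<rho> U_meas[of y], of M] U_bd by (simp add: k1_def mult_ac)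
  have i2: "integrable lebesgue (\<lambda>z. U (x + h + z) * k1 (-h + z))"
    using lebesgue_integrable_plus[OF i1[of "x + w"], of "-h"] by (simp add: hh[symmetric] algebra_simps)
  have i3: "integrable lebesgue (\<lambda>z. U (x + h + z) * k1 (h + z))"
    using lebesgue_integrable_plus[OF i1[of "x"], of "h"] by (simp add: algebra_simps)
  have "(LINT z|lebesgue. indicator {\<rho>..} (norm z) * (U (x + w + z) - U (x + z)) * k z)
    = (LINT z|lebesgue. U (x + w + z) * k1 z - U (x + z) * k1 z)"
    by (intro Bochner_Integration.integral_cong) (auto simp: k1_def algebra_simps)
  also have "\<dots> = (LINT z|lebesgue. U (x + w + z) * k1 z) - (LINT z|lebesgue. U (x + z) * k1 z)"
    using i1 by (intro Bochner_Integration.integral_diff)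
  also have "(LINT z|lebesgue. U (x + w + z) * k1 z) = (LINT z|lebesgue. U (x + h + z) * k1 (-h + z))"
    using lebesgue_integral_plus[of "\<lambda>z. U (x + w + z) * k1 z" "-h"] i1[of "x + w"]
    by (simp add: hh[symmetric] algebra_simps)
  also have "(LINT z|lebesgue. U (x + z) * k1 z) = (LINT z|lebesgue. U (x + h + z) * k1 (h + z))"
    using lebesgue_integral_plus[of "\<lambda>z. U (x + z) * k1 z" "h"] i1[of x]
    by (simp add: algebra_simps)
  finally have eq: "(LINT z|lebesgue. indicator {\<rho>..} (norm z) * (U (x + w + z) - U (x + z)) * k z)
    = (LINT z|lebesgue. U (x + h + z) * (k1 (-h + z) - k1 (h + z)))"
    using i2 i3 by (simp add: right_diff_distrib)
  \<comment> \<open>Where only one of z + h and z - h lies beyond the cut-off, no cancellation is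
    available. Such z lie within r/2 of the sphere of radius \<rho>, and there the cut kernel is at
    most Lam / \<rho>^N.\<close>
  define t where "t z = Lam / \<rho> ^ DIM('a) * (indicator {..<\<rho> + r} (norm z) - indicator {..<\<rho> - r} (norm z))" for z :: 'a
  define A where "A z = \<bar>k (z + h) - k (z - h)\<bar> * ell (norm z) * indicator (- ball 0 (2 * r)) z" for z
  have A_nonneg: "0 \<le> A z" for z by (simp add: A_def ell_nonneg)
  have t_nonneg: "0 \<le> t z" for z
    using Lam_pos \<rho>0 r by (auto simp: t_def indicator_def)
  have e0: "0 < ell (\<rho> / 2)" using \<rho>0 by (intro ell_pos) simp
  have k1_bd: "0 \<le> k1 z" "k1 z \<le> Lam / \<rho> ^ DIM('a)" for z
  proof -
    show "0 \<le> k1 z" by (simp add: k1_def k_nonneg)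
    show "k1 z \<le> Lam / \<rho> ^ DIM('a)"
    proof (cases "\<rho> \<le> norm z \<and> norm z < 1")
      case True
      then have "k z \<le> Lam / norm z ^ DIM('a)" by (intro k_upper) simp
      also have "\<dots> \<le> Lam / \<rho> ^ DIM('a)"
        using True Lam_pos \<rho>0 by (intro divide_left_mono power_mono mult_pos_pos zero_less_power) auto
      finally show ?thesis using True by (simp add: k1_def)
    next
      case False
      then have "k1 z = 0" using k_zero[of z] by (auto simp: k1_def indicator_def)
      then show ?thesis using Lam_pos \<rho>0 by simp
    qed
  qed
  have pw: "\<bar>k1 (-h + z) - k1 (h + z)\<bar> \<le> (1 / ell (\<rho> / 2)) * A z + t z" for z
  proof -
    have n: "\<bar>norm (-h + z) - norm z\<bar> \<le> r / 2" "\<bar>norm (h + z) - norm z\<bar> \<le> r / 2"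
      using norm_triangle_ineq3[of "-h + z" z] norm_triangle_ineq3[of "h + z" z] nh by auto
    consider (far) "\<rho> \<le> norm (-h + z)" "\<rho> \<le> norm (h + z)"
      | (near) "norm (-h + z) < \<rho>" "norm (h + z) < \<rho>"
      | (mixed) "\<rho> \<le> norm z + r / 2" "norm z - r / 2 < \<rho>"
      using n by linarith
    then show ?thesis
    proof cases
      case far
      \<comment> \<open>The first inequality bounds the weight from below, the second places z in
        the domain of the regularity integral.\<close>
      then have z: "\<rho> / 2 \<le> norm z" "2 * r \<le> norm z" using n r by linarith+
      have "\<bar>k1 (-h + z) - k1 (h + z)\<bar> * ell (\<rho> / 2) \<le> \<bar>k (-h + z) - k (h + z)\<bar> * ell (norm z)"
        using far z(1) e0 by (intro mult_mono ell_mono) (auto simp: k1_def)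
      also have "\<dots> = A z"
        using z(2) by (simp add: A_def abs_minus_commute add.commute)
      finally have "\<bar>k1 (-h + z) - k1 (h + z)\<bar> \<le> (1 / ell (\<rho> / 2)) * A z"
        using e0 by (simp add: field_simps)
      then show ?thesis using t_nonneg[of z] by simp
    next
      case near
      then have "k1 (-h + z) = 0" "k1 (h + z) = 0" by (auto simp: k1_def)
      then show ?thesis using t_nonneg[of z] A_nonneg[of z] e0 by simp
    next
      case mixed
      then have "t z = Lam / \<rho> ^ DIM('a)" using r by (simp add: t_def)
      moreover have "\<bar>k1 (-h + z) - k1 (h + z)\<bar> \<le> Lam / \<rho> ^ DIM('a)"
        using k1_bd[of "-h + z"] k1_bd[of "h + z"] by linarith
      moreover have "0 \<le> (1 / ell (\<rho> / 2)) * A z" using A_nonneg[of z] e0 by simp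
      ultimately show ?thesis by linarith
    qed
  qed
  have A_meas: "A \<in> borel_measurable lebesgue"
  proof -
    have [measurable]: "(\<lambda>z. k (z + h)) \<in> borel_measurable lebesgue" "(\<lambda>z. k (z - h)) \<in> borel_measurable lebesgue"
      using k_meas[of h] k_meas[of "-h"] by (simp_all add: add.commute)
    have "mono ell" by (rule monoI) (rule ell_mono)
    then have [measurable]: "ell \<in> borel_measurable borel" by (rule borel_measurable_mono)
    have [measurable]: "(\<lambda>z::'a. ell (norm z)) \<in> borel_measurable lebesgue"
      by (rule borel_measurable_lebesgueI) simp
    have [measurable]: "(indicator (- ball 0 (2 * r)) :: 'a \<Rightarrow> real) \<in> borel_measurable lebesgue"
      by (rule borel_measurable_lebesgueI) simp
    show ?thesis unfolding A_def by measurable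
  qed
  have t_int: "integrable lebesgue t"
    unfolding t_def using ball_indicator_integral(1)[of "\<rho> + r", where 'a='a]
      ball_indicator_integral(1)[of "\<rho> - r", where 'a='a] r by (intro integrable_mult_right Bochner_Integration.integrable_diff) auto
  have "integral\<^sup>L lebesgue t = Lam / \<rho> ^ DIM('a) * (unit_ball_vol (real DIM('a)) * ((\<rho> + r) ^ DIM('a) - (\<rho> - r) ^ DIM('a)))"
    unfolding t_def using ball_indicator_integral[of "\<rho> + r", where 'a='a]
      ball_indicator_integral[of "\<rho> - r", where 'a='a] r by (simp add: right_diff_distrib)
  also have "\<dots> = Lam * unit_ball_vol (real DIM('a)) * ((1 + r / \<rho>) ^ DIM('a) - (1 - r / \<rho>) ^ DIM('a))"
  proof -
    have "(\<rho> + r) ^ DIM('a) = \<rho> ^ DIM('a) * (1 + r / \<rho>) ^ DIM('a)" "(\<rho> - r) ^ DIM('a) = \<rho> ^ DIM('a) * (1 - r / \<rho>) ^ DIM('a)"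
      using \<rho>0 unfolding power_mult_distrib[symmetric] by (simp_all add: algebra_simps)
    then show ?thesis using \<rho>0 by (simp add: algebra_simps)
  qed
  \<comment> \<open>The relative volume of the shell is linear in r/\<rho>.\<close>
  also have "\<dots> \<le> Lam * unit_ball_vol (real DIM('a)) * (real DIM('a) * 2 ^ DIM('a) * (r / \<rho>))"
    using Lam_pos r \<rho>0 by (intro mult_left_mono power_diff_symmetric_le) auto
  also have "\<dots> = Lam * \<sigma> * 2 ^ DIM('a) * (r / \<rho>)" by (simp add: \<sigma>_eq)
  finally have t_le: "integral\<^sup>L lebesgue t \<le> Lam * \<sigma> * 2 ^ DIM('a) * (r / \<rho>)" .
  have A_le: "(\<integral>\<^sup>+z. ennreal (A z) \<partial>lebesgue) \<le> ennreal (Lam * ell r)"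
  proof -
    have "(\<integral>\<^sup>+z. ennreal (A z) \<partial>lebesgue) = (\<integral>\<^sup>+\<xi>. ennreal (\<bar>k (\<xi> + w /\<^sub>R 2) - k (\<xi> - w /\<^sub>R 2)\<bar> * ell (norm \<xi>))
        * indicator (- ball 0 (2 * norm w)) \<xi> \<partial>lebesgue)"
      by (intro nn_integral_cong) (auto simp: A_def h_def r_def indicator_def)
    with reg show ?thesis by (simp add: r_def)
  qed
  \<comment> \<open>Regularity is a bound on a nonnegative integral, so the estimate is carried out
    in \<open>ennreal\<close> and pulled back at the end.\<close>
  have "ennreal \<bar>LINT z|lebesgue. U (x + h + z) * (k1 (-h + z) - k1 (h + z))\<bar>
      \<le> (\<integral>\<^sup>+z. ennreal \<bar>U (x + h + z) * (k1 (-h + z) - k1 (h + z))\<bar> \<partial>lebesgue)"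
    using integral_norm_bound_ennreal[of lebesgue "\<lambda>z. U (x + h + z) * (k1 (-h + z) - k1 (h + z))"] i2 i3
    by (simp add: right_diff_distrib)
  also have "\<dots> \<le> (\<integral>\<^sup>+z. ennreal M * (ennreal (1 / ell (\<rho> / 2)) * ennreal (A z) + ennreal (t z)) \<partial>lebesgue)"
  proof (intro nn_integral_mono)
    fix z :: 'a
    have "\<bar>U (x + h + z) * (k1 (-h + z) - k1 (h + z))\<bar> \<le> M * ((1 / ell (\<rho> / 2)) * A z + t z)"
      unfolding abs_mult using U_bd pw M by (intro mult_mono) auto
    then show "ennreal \<bar>U (x + h + z) * (k1 (-h + z) - k1 (h + z))\<bar>
       \<le> ennreal M * (ennreal (1 / ell (\<rho> / 2)) * ennreal (A z) + ennreal (t z))"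
      using M e0 A_nonneg[of z] t_nonneg[of z]
      by (subst ennreal_mult''[symmetric], simp, subst ennreal_plus[symmetric], simp, simp,
          subst ennreal_mult[symmetric]) (auto intro!: ennreal_leI)
  qed
  also have "\<dots> = ennreal M * (ennreal (1 / ell (\<rho> / 2)) * (\<integral>\<^sup>+z. ennreal (A z) \<partial>lebesgue) + (\<integral>\<^sup>+z. ennreal (t z) \<partial>lebesgue))"
    using A_meas borel_measurable_integrable[OF t_int] by (simp add: nn_integral_cmult nn_integral_add)
  also have "\<dots> \<le> ennreal M * (ennreal (1 / ell (\<rho> / 2)) * ennreal (Lam * ell r) + ennreal (Lam * \<sigma> * 2 ^ DIM('a) * (r / \<rho>)))"
    using A_le t_le t_int t_nonneg
    by (intro mult_left_mono add_mono) (auto simp: nn_integral_eq_integral intro!: ennreal_leI)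
  also have "\<dots> = ennreal (M * (Lam * ell r / ell (\<rho> / 2) + Lam * \<sigma> * 2 ^ DIM('a) * (r / \<rho>)))"
    using M e0 Lam_pos \<sigma>_pos r \<rho>0 ell_nonneg[of r]
    by (subst ennreal_mult''[symmetric], simp, subst ennreal_plus[symmetric], simp, simp,
          subst ennreal_mult[symmetric]) auto
  finally show ?thesis
    using M e0 Lam_pos \<sigma>_pos r \<rho>0 ell_nonneg[of r]
    unfolding eq r_def[symmetric] by (subst (asm) ennreal_le_iff) auto
qed

end

section \<open>Increments at the scale of the distance to the boundary\<close>

text \<open>A ball is connected: if it meets both \<Omega> and the complement, it meets the
  frontier, at distance less than d.\<close>

lemma ball_subset_of_dB:
  fixes \<Omega> :: "'a::euclidean_space set"
  assumes "x \<in> \<Omega>" "d \<le> dB \<Omega> x"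
  shows "ball x d \<subseteq> \<Omega>"
proof (rule ccontr)
  assume "\<not> ball x d \<subseteq> \<Omega>"
  then have "ball x d - \<Omega> \<noteq> {}" by auto
  then obtain y where "dist x y < d" by (metis Diff_iff ex_in_conv mem_ball)
  then have "0 < d" using zero_le_dist[of x y] by linarith
  then have "x \<in> ball x d \<inter> \<Omega>" using assms(1) by simp
  then have "ball x d \<inter> \<Omega> \<noteq> {}" by blast
  then have "ball x d \<inter> frontier \<Omega> \<noteq> {}"
    using \<open>ball x d - \<Omega> \<noteq> {}\<close> by (intro connected_Int_frontier) auto
  then obtain y where "y \<in> frontier \<Omega>" "dist x y < d" by auto
  then have "infdist x (frontier \<Omega>) < d" by (meson infdist_le le_less_trans)
  with assms show False by (simp add: dB_def)
qed

text \<open>\<open>infdist\<close> to the empty set is 0, so positivity rests on the frontier being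
  nonempty, which is what \<Omega> being neither empty nor the whole space provides.\<close>

lemma dB_pos:
  fixes \<Omega> :: "'a::euclidean_space set"
  assumes "open \<Omega>" "\<Omega> \<noteq> {}" "\<Omega> \<noteq> UNIV" "x \<in> \<Omega>"
  shows "0 < dB \<Omega> x"
proof -
  have "frontier \<Omega> \<noteq> {}" using assms by (simp add: frontier_eq_empty)
  moreover have "x \<notin> frontier \<Omega>" using assms by (simp add: frontier_def interior_open)
  ultimately show ?thesis
    unfolding dB_def using in_closed_iff_infdist_zero[of "frontier \<Omega>" x] infdist_nonneg[of x "frontier \<Omega>"]
    by (simp add: less_le)
qed

lemma dB_triangle: "dB \<Omega> x - dist x y \<le> dB \<Omega> y"
  using infdist_triangle[of x "frontier \<Omega>" y] by (simp add: dB_def)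

lemma inverse_ell:
  assumes "0 < \<rho>" "\<rho> \<le> 1/10"
  shows "1 / ell \<rho> = ln (1 / \<rho>)"
  using ell_eq[OF assms(1)] assms by (simp add: min_def)

lemma one_le_ln_10: "1 \<le> ln (10::real)"
proof -
  have "exp 1 \<le> (10::real)" using exp_le by simp
  then show ?thesis using ln_ge_iff[of "10::real" 1] by simp
qed

text \<open>With r = exp(-t) this turns the cancellation error r^(1/2) into a multiple of
  1/t.\<close>

lemma exp_neg_half_le:
  fixes t :: real
  assumes "0 < t"
  shows "exp (- (t / 2)) \<le> 2 / t"
proof -
  have "t / 2 \<le> exp (t / 2)" using exp_ge_add_one_self[of "t / 2"] by linarith
  then show ?thesis using assms by (simp add: exp_minus field_simps)
qed

text \<open>In logarithmic coordinates, shrinking d by a factor c >= 1/8 adds at most ln 8 <= ln 10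
  <= 1 / ell \<delta>, hence at most doubles. The factors needed below are 1, 1/2, 1/4 and
  1/8.\<close>

lemma inverse_ell_scaled:
  assumes "0 < \<delta>" and d: "d = min \<delta> (1/10)" and c: "1/8 \<le> c" "c \<le> 1"
  shows "ln 10 \<le> 1 / ell \<delta>" and "1 \<le> 1 / ell \<delta>" and "d = exp (- (1 / ell \<delta>))"
    and "ln (1 / (c * d)) \<le> 2 * (1 / ell \<delta>)" and "1 / ell (c * d) \<le> 2 * (1 / ell \<delta>)"
proof -
  have d0: "0 < d" "d \<le> 1/10" using assms by auto
  have eq: "1 / ell \<delta> = ln (1 / d)" using assms(1) d by (simp add: ell_eq)
  show 10: "ln 10 \<le> 1 / ell \<delta>"
    unfolding eq using d0 by (subst ln_le_cancel_iff) (auto simp: field_simps)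
  then show "1 \<le> 1 / ell \<delta>" using one_le_ln_10 by simp
  show "d = exp (- (1 / ell \<delta>))" unfolding eq using d0 by (simp add: ln_div)
  have "1 / c \<le> 8" using c by (simp add: field_simps)
  then have "ln (1 / c) \<le> ln 10" using c by (subst ln_le_cancel_iff) auto
  then show *: "ln (1 / (c * d)) \<le> 2 * (1 / ell \<delta>)"
    using 10 c d0 unfolding eq by (simp add: ln_div ln_mult)
  have "c * d \<le> 1/10" using mult_mono[of c 1 d "1/10"] c d0 by simp
  then show "1 / ell (c * d) \<le> 2 * (1 / ell \<delta>)"
    using * inverse_ell[of "c * d"] c d0 by simp
qed

text \<open>The strict inequality excludes the plateau r >= 1/10, on which 1 / ell r equals ln
  10.\<close>

lemma exp_inverse_ell:
  assumes "0 < r" "ln 10 < 1 / ell r"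
  shows "r = exp (- (1 / ell r))"
proof -
  have "r < 1/10"
  proof (rule ccontr)
    assume "\<not> r < 1/10"
    then have "min r (1/10) = 1/10" by simp
    then have "ell r = 1 / ln 10" using ell_eq[OF assms(1)] by simp
    with assms(2) show False by simp
  qed
  then show ?thesis using inverse_ell[of r] assms by (simp add: ln_div)
qed

text \<open>\<open>c1\<close> and \<open>c2\<close> are the constants of the estimates of order one and two; making them
  parameters shows that they depend on \<open>lam\<close>, \<open>Lam\<close> and the dimension only.\<close>
locale log_problem = log_kernel k lam Lam \<sigma>
  for k :: "'a::euclidean_space \<Rightarrow> real" and lam Lam \<sigma> +
  fixes c1 c2 :: real and \<Omega> :: "'a set" and U :: "'a \<Rightarrow> real" and M F :: real
  assumes c1_def: "c1 = 4 * (real DIM('a) + 1) * (4 + 2 * lam * \<sigma> + 6 * Lam * \<sigma>) / (lam * \<sigma>) + 24 * (real DIM('a) + 1)"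
    and c2_def: "c2 = 4 * (real DIM('a) + 1)
        * (4 + 2 * lam * \<sigma> + 2 * c1 * Lam * \<sigma> + Lam * (2 + 8 * \<sigma> * 2 ^ DIM('a))) / (lam * \<sigma>)
      + 2 * (12 * (real DIM('a) + 1))\<^sup>2"
    and \<Omega>: "open \<Omega>" "\<Omega> \<noteq> {}" "\<Omega> \<noteq> UNIV"
    and U_meas: "U \<in> borel_measurable lebesgue" and U_bd: "\<And>x. \<bar>U x\<bar> \<le> M"
    and U_cont: "continuous_on \<Omega> U"
    and U_int: "\<And>x. x \<in> \<Omega> \<Longrightarrow> integrable lebesgue (\<lambda>z. (U x - U (x + z)) * k z)"
    and F: "0 \<le> F"
    and f_diff: "\<And>x y. x \<in> \<Omega> \<Longrightarrow> y \<in> \<Omega> \<Longrightarrow> x \<noteq> y \<Longrightarrow>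
        \<bar>(LINT z|lebesgue. (U x - U (x + z)) * k z) - (LINT z|lebesgue. (U y - U (y + z)) * k z)\<bar>
          \<le> F * ell (dist x y) / (ell (dB2 \<Omega> x y))\<^sup>2"
    and k_regular: "\<And>x w. x \<in> \<Omega> \<Longrightarrow> x + w \<in> \<Omega> \<Longrightarrow>
        (\<integral>\<^sup>+\<xi>. ennreal (\<bar>k (\<xi> + w /\<^sub>R 2) - k (\<xi> - w /\<^sub>R 2)\<bar> * ell (norm \<xi>))
        * indicator (- ball 0 (2 * norm w)) \<xi> \<partial>lebesgue) \<le> ennreal (Lam * ell (norm w))"
begin

lemma M_nonneg: "0 \<le> M"
  using U_bd[of 0] by linarith

text \<open>The maximum principle with \<rho> = d/4 and the cap radius tuned to |w|.
  \<open>H\<close> and \<open>S\<close> stay free, so that both rounds of the argument are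
  instances.\<close>

lemma increment_estimate:
  fixes x0 w :: 'a and H S :: real
  defines "D \<equiv> 1 / ell (dB2 \<Omega> x0 (x0 + w))" and "t \<equiv> 1 / ell (norm w)"
  assumes x0: "x0 \<in> \<Omega>" "x0 + w \<in> \<Omega>" and w: "w \<noteq> 0"
    and t: "12 * (real DIM('a) + 1) * D \<le> t"
    and d: "d = min (dB2 \<Omega> x0 (x0 + w)) (1/10)"
    and pos: "0 < U (x0 + w) - U x0"
    and H: "\<And>x. x \<in> ball x0 (d / 2) \<Longrightarrow> U (x + w) - U x \<le> H"
    and S: "\<And>x. x \<in> ball x0 (d / 4) \<Longrightarrow>
        (LINT z|lebesgue. indicator {d / 4..} (norm z) * (U (x + w + z) - U (x + z)) * k z) \<le> S"
  shows "lam * \<sigma> * t * (U (x0 + w) - U x0) \<le> 4 * (real DIM('a) + 1) *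
      (4 * F * D\<^sup>2 / t + 2 * lam * M * \<sigma> / t + Lam * H * \<sigma> + S)"
proof -
  let ?n = "real DIM('a)"
  define r where "r = norm w"
  \<comment> \<open>Chosen so that a^(N+1) = exp(-t/2), that is, r / a^(N+1) = r^(1/2).\<close>
  define \<theta> where "\<theta> = 1 / (2 * (?n + 1))"
  define a where "a = exp (- \<theta> * t)"
  have dB_pos': "0 < dB2 \<Omega> x0 (x0 + w)" using x0 dB_pos[OF \<Omega>] by (simp add: dB2_def)
  have d0: "0 < d" using d dB_pos' by auto
  note sc = inverse_ell_scaled[OF dB_pos' d, folded D_def]
  have D10: "ln 10 \<le> D" and D1: "1 \<le> D" and d_eq: "d = exp (- D)" using sc(1-3)[of 1] by simp_all
  have ln4: "ln 4 \<le> D" using D10 by (rule order_trans[rotated]) simp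
  have n1: "1 \<le> ?n" using DIM_positive[where 'a='a] by (simp add: Suc_leI)
  have tD: "12 * (?n + 1) * D \<le> t" by (fact t)
  have "24 * D \<le> 12 * (?n + 1) * D" using n1 D1 by (intro mult_right_mono) auto
  then have t24: "24 * D \<le> t" using tD by linarith
  have t0: "0 < t" using t24 D1 by linarith
  have r0: "0 < r" using w by (simp add: r_def)
  have "ln 10 < 1 / ell r" using t24 D10 D1 unfolding t_def r_def by linarith
  then have r_eq: "r = exp (- t)" using exp_inverse_ell[OF r0] by (simp add: t_def r_def)
  have a0: "0 < a" by (simp add: a_def)
  \<comment> \<open>This is the origin of 12(N+1) in the threshold: half of \<theta> t must absorb D
    + ln 4 + 1, which is at most 3 D.\<close>
  have \<theta>t: "6 * D \<le> \<theta> * t" using tD n1 unfolding \<theta>_def by (simp add: field_simps)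
  have ln_a: "ln (d / 4 / a) = \<theta> * t - D - ln 4"
    by (simp add: a_def d_eq ln_div ln_mult)
  then have ln_a_ge: "\<theta> * t / 2 \<le> ln (d / 4 / a) - 1" using \<theta>t ln4 D1 by linarith
  then have "0 < ln (d / 4 / a)" using \<theta>t D1 by linarith
  then have a\<rho>: "a < d / 4" using a0 d0 ln_gt_zero_iff[of "d / 4 / a"] by (simp add: field_simps)
  have sub1: "x \<in> \<Omega>" "x + w \<in> \<Omega>" "d / 2 \<le> dB2 \<Omega> x (x + w)" if "x \<in> ball x0 (d / 2)" for x
  proof -
    have "d \<le> dB \<Omega> x0" "d \<le> dB \<Omega> (x0 + w)" using d by (auto simp: dB2_def)
    then have "ball x0 d \<subseteq> \<Omega>" "ball (x0 + w) d \<subseteq> \<Omega>" using x0 ball_subset_of_dB by blast+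
    moreover have "x \<in> ball x0 d" "x + w \<in> ball (x0 + w) d" using that d0 by (auto simp: dist_norm)
    ultimately show "x \<in> \<Omega>" "x + w \<in> \<Omega>" by auto
    show "d / 2 \<le> dB2 \<Omega> x (x + w)"
      using dB_triangle[of \<Omega> x0 x] dB_triangle[of \<Omega> "x0 + w" "x + w"] that
        \<open>d \<le> dB \<Omega> x0\<close> \<open>d \<le> dB \<Omega> (x0 + w)\<close> by (simp add: dB2_def)
  qed
  have sub2: "x \<in> ball x0 (d / 2)" if "x \<in> cball x0 (d / 4)" for x using that d0 by simp
  have ell_d2: "1 / ell (d / 2) \<le> 2 * D"
    using sc(5)[of "1/2"] by simp
  have E: "(LINT z|lebesgue. (U (x + w) - U (x + w + z)) * k z)
        - (LINT z|lebesgue. (U x - U (x + z)) * k z) \<le> 4 * F * D\<^sup>2 / t" if "x \<in> ball x0 (d / 4)" for x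
  proof -
    have x: "x \<in> ball x0 (d / 2)" using that sub2 by simp
    have "(LINT z|lebesgue. (U (x + w) - U (x + w + z)) * k z)
        - (LINT z|lebesgue. (U x - U (x + z)) * k z) \<le> F * ell (dist (x + w) x) / (ell (dB2 \<Omega> (x + w) x))\<^sup>2"
      using f_diff[of "x + w" x] sub1[OF x] w by simp
    also have "\<dots> = F * (1 / t) * (1 / ell (dB2 \<Omega> x (x + w)))\<^sup>2"
      by (simp add: t_def dist_norm dB2_def min.commute power_divide)
    \<comment> \<open>Points of the ball keep distance at least d/2 from the frontier; the resulting
      factor 2 in front of D is squared.\<close>
    also have "\<dots> \<le> F * (1 / t) * (2 * D)\<^sup>2"
    proof (intro mult_left_mono power_mono)
      have "ell (d / 2) \<le> ell (dB2 \<Omega> x (x + w))" by (rule ell_mono) (rule sub1[OF x])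
      then have "1 / ell (dB2 \<Omega> x (x + w)) \<le> 1 / ell (d / 2)"
        using ell_pos[of "d / 2"] d0 by (intro divide_left_mono) auto
      then show "1 / ell (dB2 \<Omega> x (x + w)) \<le> 2 * D" using ell_d2 by simp
    qed (use F t0 ell_nonneg in auto)
    also have "\<dots> = 4 * F * D\<^sup>2 / t" by (simp add: power_mult_distrib)
    finally show ?thesis .
  qed
  have cont: "continuous_on (cball x0 (d / 4)) (\<lambda>x. U (x + w) - U x)"
    using sub1(1,2)[OF sub2]
    by (intro continuous_intros continuous_on_subset[OF U_cont] continuous_on_compose2[OF U_cont]) auto
  have "norm w / a ^ Suc DIM('a) = exp (- (t / 2))"
  proof -
    have "a ^ Suc DIM('a) = exp (real (Suc DIM('a)) * (- \<theta> * t))"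
      unfolding a_def by (rule exp_of_nat_mult[symmetric])
    also have "real (Suc DIM('a)) * (- \<theta> * t) = - (t / 2)"
      using n1 by (simp add: \<theta>_def field_simps)
    finally show ?thesis unfolding r_def[symmetric] r_eq by (simp add: exp_diff[symmetric])
  qed
  then have ra: "M * \<sigma> * norm w / a ^ Suc DIM('a) = M * \<sigma> * exp (- (t / 2))"
    by (metis times_divide_eq_right)
  have "lam * \<sigma> * (ln (d / 4 / a) - 1) * (U (x0 + w) - U x0)
    \<le> 4 * F * D\<^sup>2 / t + lam * (M * \<sigma> * norm w / a ^ Suc DIM('a)) + Lam * H * \<sigma> + S"
  proof (rule increment_max_principle[OF U_meas U_bd a0 a\<rho> _ cont _ _ E _ S pos])
    have "r \<le> exp (- D)" unfolding r_eq using t24 D1 by simp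
    moreover have "d \<le> 1/10" using d by simp
    ultimately show "d / 4 + norm w \<le> 1" using d_eq unfolding r_def by linarith
  qed (use H U_int sub1[OF sub2] in auto)
  also have "lam * (M * \<sigma> * norm w / a ^ Suc DIM('a)) \<le> lam * (M * \<sigma> * (2 / t))"
    unfolding ra
    using lam_pos M_nonneg \<sigma>_pos exp_neg_half_le[OF t0] by (intro mult_left_mono) auto
  finally have main: "lam * \<sigma> * (ln (d / 4 / a) - 1) * (U (x0 + w) - U x0)
    \<le> 4 * F * D\<^sup>2 / t + lam * (M * \<sigma> * (2 / t)) + Lam * H * \<sigma> + S" by simp
  have "lam * \<sigma> * (\<theta> * t / 2) * (U (x0 + w) - U x0) \<le> lam * \<sigma> * (ln (d / 4 / a) - 1) * (U (x0 + w) - U x0)"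
    using lam_pos \<sigma>_pos pos ln_a_ge by (intro mult_right_mono mult_left_mono) auto
  with main have "lam * \<sigma> * (\<theta> * t / 2) * (U (x0 + w) - U x0)
    \<le> 4 * F * D\<^sup>2 / t + lam * (M * \<sigma> * (2 / t)) + Lam * H * \<sigma> + S" by linarith
  also have "lam * (M * \<sigma> * (2 / t)) = 2 * lam * M * \<sigma> / t" by simp
  finally have "lam * \<sigma> * (\<theta> * t / 2) * (U (x0 + w) - U x0)
    \<le> 4 * F * D\<^sup>2 / t + 2 * lam * M * \<sigma> / t + Lam * H * \<sigma> + S" .
  \<comment> \<open>The factor 4(N+1) is 2/\<theta>, the inverse of the fraction of t kept as
    mass.\<close>
  then have "4 * (?n + 1) * (lam * \<sigma> * (\<theta> * t / 2) * (U (x0 + w) - U x0))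
    \<le> 4 * (?n + 1) * (4 * F * D\<^sup>2 / t + 2 * lam * M * \<sigma> / t + Lam * H * \<sigma> + S)"
    using n1 by (intro mult_left_mono) auto
  moreover have "4 * (?n + 1) * (lam * \<sigma> * (\<theta> * t / 2) * (U (x0 + w) - U x0)) = lam * \<sigma> * t * (U (x0 + w) - U x0)"
    using n1 by (simp add: \<theta>_def field_simps)
  ultimately show ?thesis by (simp only:)
qed

lemma c1_pos: "0 < c1"
  unfolding c1_def using lam_pos Lam_pos \<sigma>_pos by (intro add_pos_pos divide_pos_pos mult_pos_pos) auto

lemma c2_pos: "0 < c2"
  unfolding c2_def using lam_pos Lam_pos \<sigma>_pos c1_pos
  by (intro add_pos_pos divide_pos_pos mult_pos_pos) auto

section \<open>The estimates of order one and two\<close>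

lemma increment_first_order:
  assumes xy: "x \<in> \<Omega>" "y \<in> \<Omega>" "x \<noteq> y"
  shows "U x - U y \<le> c1 * (M + F) * (ell (dist x y) / ell (dB2 \<Omega> x y))"
proof -
  let ?n = "real DIM('a)"
  define w where "w = x - y"
  define D where "D = 1 / ell (dB2 \<Omega> y (y + w))"
  define t where "t = 1 / ell (norm w)"
  define d where "d = min (dB2 \<Omega> y (y + w)) (1/10)"
  define v where "v = U (y + w) - U y"
  have yw: "y + w = x" by (simp add: w_def)
  have w: "w \<noteq> 0" using xy by (simp add: w_def)
  have delta: "0 < dB2 \<Omega> y (y + w)" using xy dB_pos[OF \<Omega>] unfolding yw by (simp add: dB2_def)
  note sc = inverse_ell_scaled[OF delta d_def, folded D_def]
  have D1: "1 \<le> D" using sc(2)[of 1] by simp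
  have d0: "0 < d" "d \<le> 1/10" using delta by (auto simp: d_def)
  have t0: "0 < t" using ell_pos[of "norm w"] w by (simp add: t_def)
  have MF: "0 \<le> M + F" using M_nonneg F by simp
  have ratio: "ell (dist x y) / ell (dB2 \<Omega> x y) = D / t"
    unfolding D_def t_def yw w_def by (simp add: dist_norm dB2_def min.commute)
  \<comment> \<open>The two summands of \<open>c1\<close> serve the regime of the maximum principle
    and the trivial regime v <= 2M. In the first, 6 Lam \<sigma> collects 2 from H = 2M and 4 from
    the crude far part.\<close>
  have c1_parts: "4 * (?n + 1) * (4 + 2 * lam * \<sigma> + 6 * Lam * \<sigma>) \<le> c1 * (lam * \<sigma>)" "24 * (?n + 1) \<le> c1"
    unfolding c1_def using lam_pos Lam_pos \<sigma>_pos by (auto simp: field_simps)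
  have "v \<le> c1 * (M + F) * (D / t)"
  proof (cases "0 < v")
    case False
    moreover have "0 \<le> c1 * (M + F) * (D / t)" using c1_pos MF D1 t0 by simp
    ultimately show ?thesis by linarith
  next
    case v: True
    show ?thesis
    proof (cases "12 * (?n + 1) * D \<le> t")
      case False
      then have "1 \<le> 12 * (?n + 1) * D / t" using t0 by simp
      then have "2 * M * 1 \<le> 2 * M * (12 * (?n + 1) * D / t)" using M_nonneg by (intro mult_left_mono) auto
      moreover have "v \<le> 2 * M" using U_bd[of "y + w"] U_bd[of y] unfolding v_def by linarith
      ultimately have "v \<le> 24 * (?n + 1) * M * (D / t)" by (simp add: mult_ac)
      also have "\<dots> \<le> c1 * (M + F) * (D / t)"
        using c1_parts M_nonneg F D1 t0 by (intro mult_right_mono mult_mono) auto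
      finally show ?thesis .
    next
      case True
      have Dt: "D / t \<le> 1" 
      proof -
        have "1 * D \<le> 12 * (?n + 1) * D" using D1 by (intro mult_right_mono) auto
        then show ?thesis using True t0 by simp
      qed
      have t1: "1 / t \<le> D"
        using Dt D1 t0 by (simp add: field_simps) (smt (verit) mult_le_cancel_left1 mult_left_mono)
      have D2: "D\<^sup>2 / t \<le> D" using mult_left_mono[OF Dt, of D] D1 by (simp add: power2_eq_square)
      have "lam * \<sigma> * t * v \<le> 4 * (?n + 1) *
        (4 * F * D\<^sup>2 / t + 2 * lam * M * \<sigma> / t + Lam * (2 * M) * \<sigma> + 2 * M * Lam * \<sigma> * (2 * D))"
        unfolding v_def D_def t_def
      proof (rule increment_estimate[OF _ _ w _ d_def])
        show "y \<in> \<Omega>" "y + w \<in> \<Omega>" using xy yw by auto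
        show "12 * (real DIM('a) + 1) * (1 / ell (dB2 \<Omega> y (y + w))) \<le> 1 / ell (norm w)"
          using True by (simp add: D_def t_def)
        show "0 < U (y + w) - U y" using v by (simp add: v_def)
        show "U (x + w) - U x \<le> 2 * M" for x using U_bd[of "x + w"] U_bd[of x] by linarith
        fix x :: 'a
        have "(\<lambda>z. U (x + w + z) - U (x + z)) \<in> borel_measurable lebesgue"
          using U_meas by (intro borel_measurable_diff measurable_lebesgue_plus_comp)
        moreover have "\<bar>U (x + w + z) - U (x + z)\<bar> \<le> 2 * M" for z
          using U_bd[of "x + w + z"] U_bd[of "x + z"] by linarith
        ultimately have "\<bar>LINT z|lebesgue. indicator {d / 4..} (norm z) * (U (x + w + z) - U (x + z)) * k z\<bar>
            \<le> 2 * M * Lam * \<sigma> * ln (1 / (d / 4))"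
          using d0 by (intro integrable_far(2)) auto
        also have "\<dots> \<le> 2 * M * Lam * \<sigma> * (2 * D)"
          using sc(4)[of "1/4"] M_nonneg Lam_pos \<sigma>_pos by (intro mult_left_mono) auto
        finally show "(LINT z|lebesgue. indicator {d / 4..} (norm z) * (U (x + w + z) - U (x + z)) * k z)
            \<le> 2 * M * Lam * \<sigma> * (2 * (1 / ell (dB2 \<Omega> y (y + w))))" unfolding D_def by linarith
      qed
      also have "\<dots> \<le> 4 * (?n + 1) * ((4 + 2 * lam * \<sigma> + 6 * Lam * \<sigma>) * (M + F) * D)"
      proof (rule mult_left_mono)
        have "4 * F * D\<^sup>2 / t \<le> 4 * F * D" using mult_left_mono[OF D2, of "4 * F"] F by simp
        moreover have "2 * lam * M * \<sigma> / t \<le> 2 * lam * M * \<sigma> * D"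
          using mult_left_mono[OF t1, of "2 * lam * M * \<sigma>"] lam_pos M_nonneg \<sigma>_pos by simp
        moreover have "Lam * (2 * M) * \<sigma> \<le> Lam * (2 * M) * \<sigma> * D"
          using mult_left_mono[OF D1, of "Lam * (2 * M) * \<sigma>"] Lam_pos M_nonneg \<sigma>_pos by simp
        moreover have "0 \<le> 4 * M * D" "0 \<le> 2 * lam * \<sigma> * F * D" "0 \<le> 6 * Lam * \<sigma> * F * D"
          using M_nonneg F D1 lam_pos Lam_pos \<sigma>_pos by auto
        ultimately show "4 * F * D\<^sup>2 / t + 2 * lam * M * \<sigma> / t + Lam * (2 * M) * \<sigma> + 2 * M * Lam * \<sigma> * (2 * D)
          \<le> (4 + 2 * lam * \<sigma> + 6 * Lam * \<sigma>) * (M + F) * D" by (simp add: algebra_simps)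
      qed simp
      also have "\<dots> = (4 * (?n + 1) * (4 + 2 * lam * \<sigma> + 6 * Lam * \<sigma>)) * ((M + F) * D)" by (simp add: mult_ac)
      also have "\<dots> \<le> (c1 * (lam * \<sigma>)) * ((M + F) * D)"
        using MF D1 by (intro mult_right_mono[OF c1_parts(1)]) auto
      finally have "lam * \<sigma> * (t * v) \<le> lam * \<sigma> * (c1 * (M + F) * D)" by (simp add: mult_ac)
      then have "t * v \<le> c1 * (M + F) * D" using lam_pos \<sigma>_pos by (simp add: mult_le_cancel_left_pos)
      then show ?thesis using t0 by (simp add: field_simps)
    qed
  qed
  then show ?thesis unfolding ratio v_def yw .
qed

text \<open>The first order bound, applied at every point of the ball, replaces H = 2M by a multiple
  of D/t, and the regularity of the kernel improves the far part from D to D/t. Dividing by t then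
  gains a second factor.\<close>

lemma increment_second_order:
  assumes xy: "x \<in> \<Omega>" "y \<in> \<Omega>" "x \<noteq> y"
  shows "U x - U y \<le> c2 * (M + F) * (ell (dist x y) / ell (dB2 \<Omega> x y))\<^sup>2"
proof -
  let ?n = "real DIM('a)"
  define w where "w = x - y"
  define D where "D = 1 / ell (dB2 \<Omega> y (y + w))"
  define t where "t = 1 / ell (norm w)"
  define d where "d = min (dB2 \<Omega> y (y + w)) (1/10)"
  define v where "v = U (y + w) - U y"
  have yw: "y + w = x" by (simp add: w_def)
  have w: "w \<noteq> 0" using xy by (simp add: w_def)
  have delta: "0 < dB2 \<Omega> y (y + w)" using xy dB_pos[OF \<Omega>] unfolding yw by (simp add: dB2_def)
  note sc = inverse_ell_scaled[OF delta d_def, folded D_def]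
  have D1: "1 \<le> D" and D10: "ln 10 \<le> D" using sc(1,2)[of 1] by simp_all
  have d0: "0 < d" "d \<le> 1/10" using delta by (auto simp: d_def)
  have t0: "0 < t" using ell_pos[of "norm w"] w by (simp add: t_def)
  have MF: "0 \<le> M + F" using M_nonneg F by simp
  have ratio: "ell (dist x y) / ell (dB2 \<Omega> x y) = D / t"
    unfolding D_def t_def yw w_def by (simp add: dist_norm dB2_def min.commute)
  \<comment> \<open>The summands correspond in order to the increment of L U, the cancellation
    error, the cone height and the far part.\<close>
  define Q where "Q = 4 + 2 * lam * \<sigma> + 2 * c1 * Lam * \<sigma> + Lam * (2 + 8 * \<sigma> * 2 ^ DIM('a))"
  have c2_eq: "c2 = 4 * (?n + 1) * Q / (lam * \<sigma>) + 2 * (12 * (?n + 1))\<^sup>2" by (simp only: c2_def Q_def)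
  have Q: "0 < Q" unfolding Q_def using lam_pos Lam_pos \<sigma>_pos c1_pos by (intro add_pos_pos mult_pos_pos) auto
  have c2_parts: "4 * (?n + 1) * Q \<le> c2 * (lam * \<sigma>)" "2 * (12 * (?n + 1))\<^sup>2 \<le> c2"
  proof -
    have "c2 * (lam * \<sigma>) = 4 * (?n + 1) * Q + 2 * (12 * (?n + 1))\<^sup>2 * (lam * \<sigma>)"
      unfolding c2_eq using lam_pos \<sigma>_pos by (simp add: field_simps)
    then show "4 * (?n + 1) * Q \<le> c2 * (lam * \<sigma>)" using lam_pos \<sigma>_pos by simp
    have "0 \<le> 4 * (?n + 1) * Q / (lam * \<sigma>)"
      using lam_pos \<sigma>_pos Q by (intro divide_nonneg_nonneg mult_nonneg_nonneg) auto
    then show "2 * (12 * (?n + 1))\<^sup>2 \<le> c2" unfolding c2_eq by linarith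
  qed
  have "v \<le> c2 * (M + F) * (D / t)\<^sup>2"
  proof (cases "0 < v")
    case False
    moreover have "0 \<le> c2 * (M + F) * (D / t)\<^sup>2" using c2_pos MF by simp
    ultimately show ?thesis by linarith
  next
    case v: True
    show ?thesis
    proof (cases "12 * (?n + 1) * D \<le> t")
      case False
      then have "1 \<le> 12 * (?n + 1) * (D / t)" using t0 by simp
      then have "1 \<le> (12 * (?n + 1) * (D / t))\<^sup>2" by (rule one_le_power)
      then have "2 * M * 1 \<le> 2 * M * (12 * (?n + 1) * (D / t))\<^sup>2" using M_nonneg by (intro mult_left_mono) auto
      moreover have "v \<le> 2 * M" using U_bd[of "y + w"] U_bd[of y] unfolding v_def by linarith
      moreover have "2 * M * (12 * (?n + 1) * (D / t))\<^sup>2 = 2 * (12 * (?n + 1))\<^sup>2 * M * (D / t)\<^sup>2"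
        by (simp only: power_mult_distrib mult_ac)
      ultimately have "v \<le> 2 * (12 * (?n + 1))\<^sup>2 * M * (D / t)\<^sup>2" by linarith
      also have "\<dots> \<le> c2 * (M + F) * (D / t)\<^sup>2"
        using c2_pos M_nonneg F by (intro mult_right_mono mult_mono c2_parts) auto
      finally show ?thesis .
    next
      case True
      have "24 * D \<le> 12 * (?n + 1) * D"
        using D1 DIM_positive[where 'a='a] by (intro mult_right_mono) (auto simp: Suc_leI)
      then have t24: "24 * D \<le> t" using True by linarith
      have r: "norm w = exp (- t)"
        unfolding t_def using w t24 D10 D1 by (intro exp_inverse_ell) (auto simp: t_def[symmetric])
      have d_eq: "d = exp (- D)" using sc(3)[of 1] by simp
      have "norm w / d = exp (- t + D)" unfolding r d_eq by (simp add: exp_diff[symmetric])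
      also have "\<dots> \<le> exp (- (t / 2))" using t24 D1 by simp
      finally have rd: "norm w / d \<le> exp (- (t / 2))" .
      also have "\<dots> \<le> 2 / t" by (rule exp_neg_half_le[OF t0])
      finally have rd2: "norm w / d \<le> 2 / t" .
      have "exp (- (t / 2)) \<le> exp (- (2 * ln 4))"
      proof -
        have "ln 4 \<le> D" using D10 by (rule order_trans[rotated]) simp
        then show ?thesis using t24 D1 by simp
      qed
      also have "\<dots> = 1 / 16"
        using exp_of_nat_mult[of 2 "- ln (4::real)"] by (simp add: exp_minus power2_eq_square)
      finally have "norm w / d \<le> 1 / 16" using rd by linarith
      \<comment> \<open>Admissibility of the cut-off radius d/4 in the regularity estimate.\<close>
      then have w16: "4 * norm w \<le> d / 4" using d0 by (simp add: field_simps)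
      define H where "H = c1 * (M + F) * (2 * D / t)"
      \<comment> \<open>The factor 2 comes from \<open>ell\<close> at d/8, half the cut-off radius;
        the 8 is 4 |w|/d <= 4 * (2/t) from the shell.\<close>
      define S where "S = M * (Lam * (2 * D / t) + Lam * \<sigma> * 2 ^ DIM('a) * (8 / t))"
      have "lam * \<sigma> * t * v \<le> 4 * (?n + 1) *
        (4 * F * D\<^sup>2 / t + 2 * lam * M * \<sigma> / t + Lam * H * \<sigma> + S)"
        unfolding v_def D_def t_def
      proof (rule increment_estimate[OF _ _ w _ d_def])
        show "y \<in> \<Omega>" "y + w \<in> \<Omega>" using xy yw by auto
        show "12 * (real DIM('a) + 1) * (1 / ell (dB2 \<Omega> y (y + w))) \<le> 1 / ell (norm w)"
          using True by (simp add: D_def t_def)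
        show "0 < U (y + w) - U y" using v by (simp add: v_def)
        have dle: "d \<le> dB \<Omega> y" "d \<le> dB \<Omega> (y + w)" by (auto simp: d_def dB2_def)
        have sub: "x \<in> \<Omega>" "x + w \<in> \<Omega>" if "x \<in> ball y (d / 2)" for x
        proof -
          have "ball y d \<subseteq> \<Omega>" "ball (y + w) d \<subseteq> \<Omega>" using xy yw dle ball_subset_of_dB by blast+
          moreover have "x \<in> ball y d" "x + w \<in> ball (y + w) d" using that d0 by (auto simp: dist_norm)
          ultimately show "x \<in> \<Omega>" "x + w \<in> \<Omega>" by auto
        qed
        show "U (x + w) - U x \<le> H" if x: "x \<in> ball y (d / 2)" for x
        proof -
          have "d / 2 \<le> dB2 \<Omega> (x + w) x"
            using dB_triangle[of \<Omega> y x] dB_triangle[of \<Omega> "y + w" "x + w"] x dle by (simp add: dB2_def)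
          then have "ell (d / 2) \<le> ell (dB2 \<Omega> (x + w) x)" by (rule ell_mono)
          then have e: "1 / ell (dB2 \<Omega> (x + w) x) \<le> 1 / ell (d / 2)"
            using ell_pos[of "d / 2"] d0 by (intro divide_left_mono) auto
          have "1 / ell (d / 2) \<le> 2 * D" using sc(5)[of "1/2"] by simp
          then have "1 / t * (1 / ell (dB2 \<Omega> (x + w) x)) \<le> 1 / t * (2 * D)"
            using t0 e by (intro mult_left_mono) auto
          moreover have "ell (dist (x + w) x) / ell (dB2 \<Omega> (x + w) x) = 1 / t * (1 / ell (dB2 \<Omega> (x + w) x))"
            by (simp add: t_def dist_norm)
          ultimately have "ell (dist (x + w) x) / ell (dB2 \<Omega> (x + w) x) \<le> 2 * D / t" by simp
          then have "c1 * (M + F) * (ell (dist (x + w) x) / ell (dB2 \<Omega> (x + w) x)) \<le> H"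
            unfolding H_def using c1_pos MF by (intro mult_left_mono) auto
          moreover have "U (x + w) - U x \<le> c1 * (M + F) * (ell (dist (x + w) x) / ell (dB2 \<Omega> (x + w) x))"
            using sub[OF x] w by (intro increment_first_order) auto
          ultimately show ?thesis by linarith
        qed
        fix x assume "x \<in> ball y (d / 4)"
        then have x: "x \<in> \<Omega>" "x + w \<in> \<Omega>" using d0 by (auto intro!: sub)
        have "\<bar>LINT z|lebesgue. indicator {d / 4..} (norm z) * (U (x + w + z) - U (x + z)) * k z\<bar>
          \<le> M * (Lam * ell (norm w) / ell (d / 4 / 2) + Lam * \<sigma> * 2 ^ DIM('a) * (norm w / (d / 4)))"
          using w w16 d0 by (intro far_regular U_meas U_bd k_regular[OF x]) auto
        also have "\<dots> \<le> S"
          unfolding S_def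
        proof (intro mult_left_mono add_mono M_nonneg)
          have "Lam * ell (norm w) / ell (d / 4 / 2) = Lam * (1 / t * (1 / ell (1 / 8 * d)))" by (simp add: t_def)
          also have "\<dots> \<le> Lam * (1 / t * (2 * D))"
            using sc(5)[of "1/8"] Lam_pos t0 by (intro mult_left_mono) auto
          finally show "Lam * ell (norm w) / ell (d / 4 / 2) \<le> Lam * (2 * D / t)" by simp
          show "norm w / (d / 4) \<le> 8 / t" using mult_left_mono[OF rd2, of 4] by (simp add: mult.commute)
        qed (use Lam_pos \<sigma>_pos in auto)
        finally show "(LINT z|lebesgue. indicator {d / 4..} (norm z) * (U (x + w + z) - U (x + z)) * k z) \<le> S"
          by linarith
      qed
      also have "\<dots> \<le> 4 * (?n + 1) * (Q * (M + F) * (D\<^sup>2 / t))"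
      proof (rule mult_left_mono)
        \<comment> \<open>As D >= 1, every term is dominated by the order D^2/t of the data
          term.\<close>
        have DD: "1 / t \<le> D\<^sup>2 / t" "D / t \<le> D\<^sup>2 / t"
          using D1 t0 by (auto simp: power2_eq_square intro!: divide_right_mono mult_ge1_I)
        have "4 * F * D\<^sup>2 / t = 4 * F * (D\<^sup>2 / t)" by simp
        moreover have "2 * lam * M * \<sigma> / t \<le> 2 * lam * M * \<sigma> * (D\<^sup>2 / t)"
          using mult_left_mono[OF DD(1), of "2 * lam * M * \<sigma>"] lam_pos M_nonneg \<sigma>_pos by simp
        moreover have "Lam * H * \<sigma> \<le> 2 * c1 * Lam * \<sigma> * (M + F) * (D\<^sup>2 / t)"
          using mult_left_mono[OF DD(2), of "2 * c1 * Lam * \<sigma> * (M + F)"] Lam_pos c1_pos \<sigma>_pos MF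
          by (simp add: H_def mult_ac)
        moreover have "S \<le> M * Lam * (2 + 8 * \<sigma> * 2 ^ DIM('a)) * (D\<^sup>2 / t)"
        proof -
          have "M * Lam * 2 * (D / t) \<le> M * Lam * 2 * (D\<^sup>2 / t)"
            using DD(2) M_nonneg Lam_pos by (intro mult_left_mono) auto
          moreover have "M * Lam * (8 * \<sigma> * 2 ^ DIM('a)) * (1 / t) \<le> M * Lam * (8 * \<sigma> * 2 ^ DIM('a)) * (D\<^sup>2 / t)"
            using DD(1) M_nonneg Lam_pos \<sigma>_pos by (intro mult_left_mono) auto
          ultimately show ?thesis unfolding S_def by (simp add: algebra_simps)
        qed
        moreover have "0 \<le> 4 * M * (D\<^sup>2 / t)" "0 \<le> 2 * lam * F * \<sigma> * (D\<^sup>2 / t)"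
            "0 \<le> F * Lam * (2 + 8 * \<sigma> * 2 ^ DIM('a)) * (D\<^sup>2 / t)"
          using M_nonneg F t0 lam_pos Lam_pos \<sigma>_pos by auto
        moreover have "Q * (M + F) * (D\<^sup>2 / t) = 4 * F * (D\<^sup>2 / t) + 2 * lam * M * \<sigma> * (D\<^sup>2 / t)
            + 2 * c1 * Lam * \<sigma> * (M + F) * (D\<^sup>2 / t) + M * Lam * (2 + 8 * \<sigma> * 2 ^ DIM('a)) * (D\<^sup>2 / t)
            + 4 * M * (D\<^sup>2 / t) + 2 * lam * F * \<sigma> * (D\<^sup>2 / t) + F * Lam * (2 + 8 * \<sigma> * 2 ^ DIM('a)) * (D\<^sup>2 / t)"
          unfolding Q_def by algebra
        ultimately show "4 * F * D\<^sup>2 / t + 2 * lam * M * \<sigma> / t + Lam * H * \<sigma> + S \<le> Q * (M + F) * (D\<^sup>2 / t)"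
          by linarith
      qed simp
      also have "\<dots> = (4 * (?n + 1) * Q) * ((M + F) * (D\<^sup>2 / t))" by (simp only: mult_ac)
      also have "\<dots> \<le> (c2 * (lam * \<sigma>)) * ((M + F) * (D\<^sup>2 / t))"
        using MF t0 by (intro mult_right_mono[OF c2_parts(1)]) auto
      finally have "lam * \<sigma> * (t * v) \<le> lam * \<sigma> * (c2 * (M + F) * (D\<^sup>2 / t))" by (simp only: mult_ac)
      then have "t * v \<le> c2 * (M + F) * (D\<^sup>2 / t)"
        by (metis mult_le_cancel_left_pos mult_pos_pos lam_pos \<sigma>_pos)
      then show ?thesis using t0 by (simp add: field_simps power2_eq_square)
    qed
  qed
  then show ?thesis unfolding ratio v_def yw .
qed

end

section \<open>Interior regularity\<close>

lemma Linf_bound: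
  assumes "Linf S u < \<infinity>"
  obtains m where "0 \<le> m" "e2ennreal (Linf S u) = ennreal m" "AE x in lebesgue_on S. \<bar>u x\<bar> \<le> m"
proof -
  have AE: "AE x in lebesgue_on S. ereal \<bar>u x\<bar> \<le> Linf S u"
    unfolding Linf_def by (rule esssup_AE)
  show thesis
  proof (cases "Linf S u")
    case (real a)
    show thesis
    proof (rule that[of "max 0 a"])
      show "AE x in lebesgue_on S. \<bar>u x\<bar> \<le> max 0 a"
        using AE by eventually_elim (simp add: real le_max_iff_disj)
    qed (auto simp: real max_def ennreal_neg)
  next
    \<comment> \<open>The essential supremum over a null set is minus infinity;
      \<open>e2ennreal\<close> sends it to 0, and the almost everywhere bound holds
      vacuously.\<close>
    case MInf
    show thesis
    proof (rule that[of 0])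
      show "AE x in lebesgue_on S. \<bar>u x\<bar> \<le> 0"
        using AE by eventually_elim (simp add: MInf)
    qed (auto simp: MInf e2ennreal_neg)
  qed (use assms in simp)
qed

lemma Dini_loc_continuous:
  assumes "open \<Omega>" "Dini_loc \<Omega> u"
  shows "continuous_on \<Omega> u"
proof (rule continuous_at_imp_continuous_on, rule ballI)
  fix x assume "x \<in> \<Omega>"
  then obtain r where r: "0 < r" "cball x r \<subseteq> \<Omega>" using assms(1) open_contains_cball by blast
  then obtain \<omega> where \<omega>: "modulus \<omega>" "\<And>y z. y \<in> cball x r \<Longrightarrow> z \<in> cball x r \<Longrightarrow> \<bar>u y - u z\<bar> \<le> \<omega> (dist y z)"
    using assms(2) unfolding Dini_loc_def by blast
  show "isCont u x"
    unfolding continuous_at_eps_delta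
  proof (intro allI impI)
    fix e :: real assume "0 < e"
    then have "\<forall>\<^sub>F t in at_right 0. \<omega> t < e"
      using \<omega>(1) unfolding modulus_def by (auto dest: order_tendstoD(2))
    then obtain b where b: "0 < b" "\<And>t. 0 < t \<Longrightarrow> t < b \<Longrightarrow> \<omega> t < e"
      unfolding eventually_at_right_field by blast
    have "dist (u y) (u x) < e" if "dist y x < min b r" for y
    proof (cases "y = x")
      case False
      then have "\<omega> (dist y x) < e" using that by (intro b) auto
      moreover have "\<bar>u y - u x\<bar> \<le> \<omega> (dist y x)" using that r by (intro \<omega>(2)) (auto simp: dist_commute)
      ultimately show ?thesis by (simp add: dist_real_def)
    qed (use \<open>0 < e\<close> in simp)
    then show "\<exists>d>0. \<forall>y. dist y x < d \<longrightarrow> dist (u y) (u x) < e"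
      using b r by (intro exI[of _ "min b r"]) auto
  qed
qed

text \<open>The set where the bound fails is open by continuity, and a nonempty open set is not
  negligible.\<close>

lemma continuous_AE_bound:
  fixes u :: "'a::euclidean_space \<Rightarrow> real"
  assumes "open \<Omega>" "continuous_on \<Omega> u" "AE x in lebesgue. x \<in> \<Omega> \<longrightarrow> \<bar>u x\<bar> \<le> m" "x \<in> \<Omega>"
  shows "\<bar>u x\<bar> \<le> m"
proof (rule ccontr)
  define A where "A = \<Omega> \<inter> (\<lambda>y. \<bar>u y\<bar>) -` {m<..}"
  assume "\<not> \<bar>u x\<bar> \<le> m"
  then have "A \<noteq> {}" using assms(4) by (auto simp: A_def)
  moreover have "open A"
    unfolding A_def using assms(1,2) by (intro continuous_open_preimage continuous_intros) auto
  moreover have "negligible A"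
  proof -
    obtain N where N: "N \<in> null_sets lebesgue" "{y. \<not> (y \<in> \<Omega> \<longrightarrow> \<bar>u y\<bar> \<le> m)} \<subseteq> N"
      using assms(3) unfolding eventually_ae_filter by auto
    then have "A \<subseteq> N" by (auto simp: A_def)
    then show ?thesis using N(1) negligible_subset negligible_iff_null_sets by blast
  qed
  ultimately show False using open_not_negligible by blast
qed

lemma B1_open: "open (B1 \<Omega>)" and subset_B1: "\<Omega> \<subseteq> B1 \<Omega>"
  by (auto simp: B1_def)

text \<open>Transfers the hypotheses on u, bounded only almost everywhere on the neighbourhood
  \<open>B1 \<Omega>\<close>, to a function on the whole space that is bounded everywhere, as
  translation arguments require.\<close>

lemma increment_bound:
  fixes \<Omega> :: "'a::euclidean_space set" and K u :: "'a \<Rightarrow> real" and lam Lam :: real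
  defines "\<sigma> \<equiv> real DIM('a) * unit_ball_vol (real DIM('a))"
  defines "c1 \<equiv> 4 * (real DIM('a) + 1) * (4 + 2 * lam * \<sigma> + 6 * Lam * \<sigma>) / (lam * \<sigma>) + 24 * (real DIM('a) + 1)"
  defines "c2 \<equiv> 4 * (real DIM('a) + 1)
        * (4 + 2 * lam * \<sigma> + 2 * c1 * Lam * \<sigma> + Lam * (2 + 8 * \<sigma> * 2 ^ DIM('a))) / (lam * \<sigma>)
      + 2 * (12 * (real DIM('a) + 1))\<^sup>2"
  assumes lam: "0 < lam" and \<Omega>: "open \<Omega>" "\<Omega> \<noteq> {}" "\<Omega> \<noteq> UNIV"
    and K_meas: "K \<in> borel_measurable (lebesgue_on (ball 0 1))"
    and K_bd: "\<forall>y\<in>ball 0 1. lam \<le> K y \<and> K y \<le> Lam"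
    and reg: "regular 1 Lam \<Omega> K"
    and u_meas: "u \<in> borel_measurable (lebesgue_on (B1 \<Omega>))"
    and m: "0 \<le> m" "AE x in lebesgue_on (B1 \<Omega>). \<bar>u x\<bar> \<le> m"
    and Dini: "Dini_loc \<Omega> u"
    and F: "0 \<le> F" "wnorm 1 1 \<Omega> (LK K u) \<le> ennreal F"
  shows "0 < c2" and "x \<in> \<Omega> \<Longrightarrow> \<bar>u x\<bar> \<le> m"
    and "x \<in> \<Omega> \<Longrightarrow> y \<in> \<Omega> \<Longrightarrow> x \<noteq> y \<Longrightarrow>
      \<bar>u x - u y\<bar> \<le> c2 * (m + F) * (ell (dist x y) / ell (dB2 \<Omega> x y))\<^sup>2"
proof -
  have cont: "continuous_on \<Omega> u" using \<Omega>(1) Dini by (rule Dini_loc_continuous)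
  have B1_sets: "B1 \<Omega> \<in> sets lebesgue"
    using B1_open[of \<Omega>] by (intro sets_completionI_sets) (simp add: borel_open)
  have AE_m: "AE x in lebesgue. x \<in> B1 \<Omega> \<longrightarrow> \<bar>u x\<bar> \<le> m"
    using m(2) B1_sets by (subst (asm) AE_restrict_space_iff) auto
  have u_m: "\<bar>u x\<bar> \<le> m" if "x \<in> \<Omega>" for x
    using AE_m subset_B1[of \<Omega>] by (intro continuous_AE_bound[OF \<Omega>(1) cont _ that]) (auto elim!: eventually_mono)
  then show "x \<in> \<Omega> \<Longrightarrow> \<bar>u x\<bar> \<le> m" .
  define u0 where "u0 x = (if x \<in> B1 \<Omega> then u x else 0)" for x
  \<comment> \<open>The values exceeding m form a null set disjoint from \<Omega>, so resetting them
    to 0 changes neither the integrals nor u on \<Omega>.\<close>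
  define U where "U x = (if \<bar>u0 x\<bar> \<le> m then u0 x else 0)" for x
  define k where "k z = Kext K z / norm z ^ DIM('a)" for z
  have u0_meas[measurable]: "u0 \<in> borel_measurable lebesgue"
    unfolding u0_def[abs_def] using u_meas B1_sets by (rule borel_measurable_if_I)
  have U_meas[measurable]: "U \<in> borel_measurable lebesgue"
    unfolding U_def[abs_def] by measurable
  have U_bd: "\<bar>U x\<bar> \<le> m" for x using m(1) by (simp add: U_def)
  have U_eq: "U x = u x" "u0 x = u x" if "x \<in> \<Omega>" for x
    using that subset_B1[of \<Omega>] u_m[OF that] by (auto simp: U_def u0_def)
  have AE_U: "AE x in lebesgue. U x = u0 x"
    using AE_m by eventually_elim (use m(1) in \<open>auto simp: U_def u0_def\<close>)
  have [measurable]: "Kext K \<in> borel_measurable lebesgue"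
    unfolding Kext_def[abs_def] using K_meas by (rule borel_measurable_if_I) simp
  have [measurable]: "(\<lambda>z::'a. norm z ^ DIM('a)) \<in> borel_measurable lebesgue"
    by (rule borel_measurable_lebesgueI) simp
  have k_meas[measurable]: "k \<in> borel_measurable lebesgue"
    unfolding k_def[abs_def] by measurable
  have Lam: "0 < Lam" using K_bd[rule_format, of 0] lam by auto
  interpret log_kernel k lam Lam \<sigma>
  proof
    show "lam / norm z ^ DIM('a) \<le> k z" if "norm z < 1" for z
      using that K_bd[rule_format, of z] by (auto simp: k_def Kext_def intro!: divide_right_mono)
    show "k z \<le> Lam / norm z ^ DIM('a)" if "norm z < 1" for z
      using that K_bd[rule_format, of z] by (auto simp: k_def Kext_def intro!: divide_right_mono)
    show "k z = 0" if "1 \<le> norm z" for z using that by (simp add: k_def Kext_def)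
  qed (use lam Lam in \<open>auto simp: \<sigma>_def\<close>)
  have LK_eq: "LK K u x = (LINT z|lebesgue. (U x - U (x + z)) * k z)" if x: "x \<in> \<Omega>" for x
  proof -
    have k_shift: "(\<lambda>y. k (- x + y)) \<in> borel_measurable lebesgue"
      by (rule measurable_lebesgue_plus_comp) simp
    have "LK K u x = (LINT y|lebesgue. (U x - u0 y) * k (- x + y))"
      unfolding LK_def set_lebesgue_integral_def
    proof (intro Bochner_Integration.integral_cong refl)
      fix y
      show "indicat_real (ball x 1) y *\<^sub>R ((u x - u y) / norm (y - x) ^ DIM('a) * K (y - x)) = (U x - u0 y) * k (- x + y)"
      proof (cases "y \<in> ball x 1")
        case True
        then have "y \<in> B1 \<Omega>" using x by (auto simp: B1_def)
        then show ?thesis using True x by (simp add: U_eq u0_def k_def Kext_def dist_norm norm_minus_commute)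
      next
        case False
        then show ?thesis by (simp add: k_def Kext_def dist_norm norm_minus_commute)
      qed
    qed
    also have "\<dots> = (LINT y|lebesgue. (U x - U y) * k (- x + y))"
    proof (rule integral_cong_AE)
      show "AE y in lebesgue. (U x - u0 y) * k (- x + y) = (U x - U y) * k (- x + y)"
        using AE_U by eventually_elim simp
    qed (use k_shift in measurable)
    also have "\<dots> = (LINT z|lebesgue. (U x - U (x + z)) * k z)"
      using lebesgue_integral_plus[of "\<lambda>y. (U x - U y) * k (- x + y)" x] k_shift by simp
    finally show ?thesis .
  qed
  interpret log_problem k lam Lam \<sigma> c1 c2 \<Omega> U m F
  proof
    show "c1 = 4 * (real DIM('a) + 1) * (4 + 2 * lam * \<sigma> + 6 * Lam * \<sigma>) / (lam * \<sigma>) + 24 * (real DIM('a) + 1)"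
      by (simp only: c1_def)
    show "c2 = 4 * (real DIM('a) + 1)
        * (4 + 2 * lam * \<sigma> + 2 * c1 * Lam * \<sigma> + Lam * (2 + 8 * \<sigma> * 2 ^ DIM('a))) / (lam * \<sigma>)
      + 2 * (12 * (real DIM('a) + 1))\<^sup>2"
      by (simp only: c2_def)
    show "open \<Omega>" "\<Omega> \<noteq> {}" "\<Omega> \<noteq> UNIV" "U \<in> borel_measurable lebesgue" "0 \<le> F" "\<And>x. \<bar>U x\<bar> \<le> m"
      using \<Omega> F U_bd by simp_all
    show "continuous_on \<Omega> U" using cont U_eq(1) by (simp cong: continuous_on_cong)
    show "integrable lebesgue (\<lambda>z. (U x - U (x + z)) * k z)" if x: "x \<in> \<Omega>" for x
    proof -
      obtain r where r: "0 < r" "cball x r \<subseteq> \<Omega>" using x \<Omega>(1) open_contains_cball by blast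
      \<comment> \<open>The Dini integral runs over radii up to 1 only.\<close>
      then have "cball x (min r 1) \<subseteq> \<Omega>" by auto
      then obtain \<omega> where \<omega>: "modulus \<omega>"
          "\<And>y z. y \<in> cball x (min r 1) \<Longrightarrow> z \<in> cball x (min r 1) \<Longrightarrow> \<bar>u y - u z\<bar> \<le> \<omega> (dist y z)"
          "set_nn_integral lebesgue {0<..1} (\<lambda>\<rho>. ennreal (\<omega> \<rho> / \<rho>)) < \<infinity>"
        using Dini unfolding Dini_loc_def by blast
      show ?thesis
      proof (rule integrable_of_Dini[OF U_meas U_bd _ _ \<omega>(1) _ \<omega>(3)])
        fix z :: 'a assume z: "norm z < min r 1"
        then have "x + z \<in> cball x (min r 1)" by (simp add: dist_norm)
        moreover from this have "x + z \<in> \<Omega>" using \<open>cball x (min r 1) \<subseteq> \<Omega>\<close> by blast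
        ultimately show "\<bar>U x - U (x + z)\<bar> \<le> \<omega> (norm z)"
          using \<omega>(2)[of x "x + z"] r x U_eq(1)[of "x + z"] U_eq(1)[of x] by (simp add: dist_norm)
      qed (use r in auto)
    qed
    show "\<bar>(LINT z|lebesgue. (U x - U (x + z)) * k z) - (LINT z|lebesgue. (U y - U (y + z)) * k z)\<bar>
          \<le> F * ell (dist x y) / (ell (dB2 \<Omega> x y))\<^sup>2" if xy: "x \<in> \<Omega>" "y \<in> \<Omega>" "x \<noteq> y" for x y
    proof -
      let ?f = "LK K u"
      have pos: "0 < ell (dB2 \<Omega> x y)" "0 < ell (dist x y)"
        using xy dB_pos[OF \<Omega>] by (auto intro!: ell_pos simp: dB2_def)
      have "ennreal (ell (dB2 \<Omega> x y) powr (1 + 1) * \<bar>?f x - ?f y\<bar> / ell (dist x y) powr 1) \<le> wsemi 1 1 \<Omega> ?f"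
        unfolding wsemi_def using xy by (intro SUP_upper2[of "(x, y)"]) auto
      also have "\<dots> \<le> wnorm 1 1 \<Omega> ?f" by (simp add: wnorm_def)
      also have "\<dots> \<le> ennreal F" by (rule F)
      finally have "ell (dB2 \<Omega> x y) powr (1 + 1) * \<bar>?f x - ?f y\<bar> / ell (dist x y) powr 1 \<le> F"
        using F by (simp add: ennreal_le_iff)
      then have "(ell (dB2 \<Omega> x y))\<^sup>2 * \<bar>?f x - ?f y\<bar> / ell (dist x y) \<le> F"
        using pos by (simp add: powr_numeral)
      then have "\<bar>?f x - ?f y\<bar> \<le> F * ell (dist x y) / (ell (dB2 \<Omega> x y))\<^sup>2"
        using pos by (simp add: field_simps)
      then show ?thesis using xy by (simp add: LK_eq)
    qed
    show "(\<integral>\<^sup>+\<xi>. ennreal (\<bar>k (\<xi> + w /\<^sub>R 2) - k (\<xi> - w /\<^sub>R 2)\<bar> * ell (norm \<xi>))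
        * indicator (- ball 0 (2 * norm w)) \<xi> \<partial>lebesgue) \<le> ennreal (Lam * ell (norm w))"
      if "x \<in> \<Omega>" "x + w \<in> \<Omega>" for x w
    proof -
      \<comment> \<open>Regularity is stated around the midpoint of the two points, here x +
        w/2.\<close>
      have "x + w /\<^sub>R 2 + w /\<^sub>R 2 = x + w" by (simp add: add.assoc scaleR_2[symmetric])
      then have "x + w /\<^sub>R 2 + w /\<^sub>R 2 \<in> \<Omega>" "x + w /\<^sub>R 2 - w /\<^sub>R 2 \<in> \<Omega>"
        using that by (simp_all only: add_diff_cancel_right')
      then show ?thesis
        using reg[unfolded regular_def, rule_format, of "x + w /\<^sub>R 2" w] ell_nonneg[of "norm w"]
        by (simp only: k_def powr_one)
    qed
  qed
  show "0 < c2" by (rule c2_pos)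
  show "\<bar>u x - u y\<bar> \<le> c2 * (m + F) * (ell (dist x y) / ell (dB2 \<Omega> x y))\<^sup>2"
    if "x \<in> \<Omega>" "y \<in> \<Omega>" "x \<noteq> y"
    using increment_second_order[of x y] increment_second_order[of y x] that U_eq(1)
    by (simp add: dist_commute dB2_def min.commute abs_le_iff)
qed

section \<open>Passage to the weighted and local seminorms\<close>

lemma wnorm_le:
  fixes u :: "'a::euclidean_space \<Rightarrow> real"
  assumes \<Omega>: "open \<Omega>" "\<Omega> \<noteq> {}" "\<Omega> \<noteq> UNIV" and \<beta>: "0 \<le> \<beta>" "\<beta> \<le> 2"
    and bd: "\<And>x. x \<in> \<Omega> \<Longrightarrow> \<bar>u x\<bar> \<le> m" and m: "0 \<le> m" "2 * m \<le> A"
    and inc: "\<And>x y. x \<in> \<Omega> \<Longrightarrow> y \<in> \<Omega> \<Longrightarrow> x \<noteq> y \<Longrightarrow>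
      \<bar>u x - u y\<bar> \<le> A * (ell (dist x y) / ell (dB2 \<Omega> x y))\<^sup>2"
  shows "wnorm 0 \<beta> \<Omega> u \<le> ennreal (m + A)"
proof -
  have "(SUP x\<in>\<Omega>. ennreal (ell (dB \<Omega> x) powr 0 * \<bar>u x\<bar>)) \<le> ennreal m"
    using bd by (intro SUP_least ennreal_leI) (auto simp: m)
  moreover have "wsemi 0 \<beta> \<Omega> u \<le> ennreal A"
    unfolding wsemi_def
  proof (intro SUP_least ennreal_leI, clarsimp)
    fix x y assume xy: "x \<in> \<Omega>" "y \<in> \<Omega>" "x \<noteq> y"
    define p q where "p = ell (dB2 \<Omega> x y)" and "q = ell (dist x y)"
    have pos: "0 < p" "0 < q"
      using xy dB_pos[OF \<Omega>] by (auto intro!: ell_pos simp: dB2_def p_def q_def)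
    have A: "0 \<le> A" using m by linarith
    have "\<bar>u x - u y\<bar> \<le> A * (q / p) powr \<beta>"
    \<comment> \<open>Below 1 a smaller exponent only weakens the quadratic bound; above 1 the
      trivial bound 2m <= A is enough.\<close>
    proof (cases "q / p \<le> 1")
      case True
      have "(q / p)\<^sup>2 = (q / p) powr 2" using pos by (simp add: powr_numeral)
      also have "\<dots> \<le> (q / p) powr \<beta>" using True pos \<beta> by (intro powr_mono') auto
      finally have "A * (q / p)\<^sup>2 \<le> A * (q / p) powr \<beta>" using A by (intro mult_left_mono) auto
      then show ?thesis using inc[OF xy] by (simp add: p_def q_def)
    next
      case False
      then have "1 \<le> (q / p) powr \<beta>" using \<beta> by (intro ge_one_powr_ge_zero) auto
      then have "A * 1 \<le> A * (q / p) powr \<beta>" using A by (intro mult_left_mono) auto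
      then show ?thesis using bd[of x] bd[of y] xy m by linarith
    qed
    then show "ell (dB2 \<Omega> x y) powr \<beta> * \<bar>u x - u y\<bar> / ell (dist x y) powr \<beta> \<le> A"
      using pos by (simp add: p_def[symmetric] q_def[symmetric] powr_divide field_simps)
  qed
  ultimately show ?thesis
    unfolding wnorm_def using m by (subst ennreal_plus) (auto intro: add_mono)
qed

text \<open>On a compact ball in \<Omega> the distance to the frontier has a positive minimum, so
  the weight is bounded below and can be divided out.\<close>

lemma Lloc_of_wnorm:
  fixes u :: "'a::euclidean_space \<Rightarrow> real"
  assumes \<Omega>: "open \<Omega>" "\<Omega> \<noteq> {}" "\<Omega> \<noteq> UNIV" and \<beta>: "0 \<le> \<beta>"
    and cont: "continuous_on \<Omega> u" and bd: "\<And>x. x \<in> \<Omega> \<Longrightarrow> \<bar>u x\<bar> \<le> m"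
    and fin: "wnorm 0 \<beta> \<Omega> u \<le> ennreal A" "0 \<le> A"
  shows "Lloc \<beta> \<Omega> u"
  unfolding Lloc_def
proof (intro conjI cont allI impI)
  fix c :: 'a and r :: real
  assume r: "0 < r" and sub: "cball c r \<subseteq> \<Omega>"
  have "continuous_on (cball c r) (dB \<Omega>)"
    unfolding dB_def[abs_def] by (intro continuous_on_infdist continuous_on_id)
  then obtain z where z: "z \<in> cball c r" "\<And>x. x \<in> cball c r \<Longrightarrow> dB \<Omega> z \<le> dB \<Omega> x"
    using continuous_attains_inf[of "cball c r" "dB \<Omega>"] r by auto
  have e: "0 < ell (dB \<Omega> z)" using z(1) sub dB_pos[OF \<Omega>] by (intro ell_pos) auto
  have "(SUP x\<in>ball c r. ennreal \<bar>u x\<bar>) \<le> ennreal m"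
    using sub by (intro SUP_least ennreal_leI bd) auto
  moreover have "lsemi \<beta> (ball c r) u \<le> ennreal (A / ell (dB \<Omega> z) powr \<beta>)"
    unfolding lsemi_def
  proof (intro SUP_least ennreal_leI, clarsimp)
    fix x y assume xy: "dist c x < r" "dist c y < r" "x \<noteq> y"
    have in\<Omega>: "x \<in> \<Omega>" "y \<in> \<Omega>" using xy sub by auto
    have "ennreal (ell (dB2 \<Omega> x y) powr (\<beta> + 0) * \<bar>u x - u y\<bar> / ell (dist x y) powr \<beta>) \<le> wsemi 0 \<beta> \<Omega> u"
      unfolding wsemi_def using xy in\<Omega> by (intro SUP_upper2[of "(x, y)"]) auto
    also have "\<dots> \<le> wnorm 0 \<beta> \<Omega> u" by (simp add: wnorm_def)
    also have "\<dots> \<le> ennreal A" by (rule fin)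
    finally have "ell (dB2 \<Omega> x y) powr \<beta> * (\<bar>u x - u y\<bar> / ell (dist x y) powr \<beta>) \<le> A"
      using fin(2) by (simp add: ennreal_le_iff)
    moreover have "ell (dB \<Omega> z) powr \<beta> \<le> ell (dB2 \<Omega> x y) powr \<beta>"
      using e \<beta> z(2)[of x] z(2)[of y] xy by (intro powr_mono2 ell_mono) (auto simp: dB2_def)
    then have "ell (dB \<Omega> z) powr \<beta> * (\<bar>u x - u y\<bar> / ell (dist x y) powr \<beta>)
        \<le> ell (dB2 \<Omega> x y) powr \<beta> * (\<bar>u x - u y\<bar> / ell (dist x y) powr \<beta>)"
      by (intro mult_right_mono) auto
    ultimately have "ell (dB \<Omega> z) powr \<beta> * (\<bar>u x - u y\<bar> / ell (dist x y) powr \<beta>) \<le> A" by linarith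
    then show "\<bar>u x - u y\<bar> / ell (dist x y) powr \<beta> \<le> A / ell (dB \<Omega> z) powr \<beta>"
      using e by (simp add: pos_le_divide_eq mult.commute)
  qed
  ultimately show "(SUP x\<in>ball c r. ennreal \<bar>u x\<bar>) + lsemi \<beta> (ball c r) u < \<infinity>"
    by (metis (no_types, lifting) add_mono ennreal_add_less_top ennreal_less_top infinity_ennreal_def le_less_trans)
qed

theorem theorem4p10:
  fixes lam Lam :: real
  assumes "0 < lam"
  shows "\<exists>\<alpha>::real. 0 < \<alpha> \<and> \<alpha> < 1 \<and>
    (\<forall>R::real. \<exists>C::real. C > 0 \<and>
      (\<forall>(\<Omega>::'a::euclidean_space set) (K::'a \<Rightarrow> real) (u::'a \<Rightarrow> real).
         open \<Omega> \<and> \<Omega> \<noteq> {} \<and> \<Omega> \<noteq> UNIV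
         \<and> bdd_above (dB \<Omega> ` \<Omega>) \<and> (SUP x\<in>\<Omega>. dB \<Omega> x) = R
         \<and> K \<in> borel_measurable (lebesgue_on (ball 0 1))
         \<and> (\<forall>y\<in>ball 0 1. lam \<le> K y \<and> K y \<le> Lam)
         \<and> regular 1 Lam \<Omega> K
         \<and> u \<in> borel_measurable (lebesgue_on (B1 \<Omega>))
         \<and> Linf (B1 \<Omega>) u < \<infinity>
         \<and> Dini_loc \<Omega> u
         \<and> wnorm 1 1 \<Omega> (LK K u) < \<infinity>
         \<longrightarrow> Lloc (1 + \<alpha>) \<Omega> u
           \<and> wnorm 0 (1 + \<alpha>) \<Omega> u
               \<le> ennreal C * (e2ennreal (Linf (B1 \<Omega>) u) + wnorm 1 1 \<Omega> (LK K u))))"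
proof -
  define \<sigma> where "\<sigma> = real DIM('a) * unit_ball_vol (real DIM('a))"
  define c1 where "c1 = 4 * (real DIM('a) + 1) * (4 + 2 * lam * \<sigma> + 6 * Lam * \<sigma>) / (lam * \<sigma>) + 24 * (real DIM('a) + 1)"
  define c2 where "c2 = 4 * (real DIM('a) + 1)
        * (4 + 2 * lam * \<sigma> + 2 * c1 * Lam * \<sigma> + Lam * (2 + 8 * \<sigma> * 2 ^ DIM('a))) / (lam * \<sigma>)
      + 2 * (12 * (real DIM('a) + 1))\<^sup>2"
  \<comment> \<open>The constant is fixed before \<Omega>, K and u, while positivity of
    \<open>c2\<close> is known only once a kernel with these bounds is given; the absolute value
    keeps the constant positive in any case.\<close>
  have main: "Lloc (1 + 1/2) \<Omega> u \<and> wnorm 0 (1 + 1/2) \<Omega> u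
      \<le> ennreal (\<bar>c2\<bar> + 3) * (e2ennreal (Linf (B1 \<Omega>) u) + wnorm 1 1 \<Omega> (LK K u))"
    if h: "open \<Omega>" "\<Omega> \<noteq> {}" "\<Omega> \<noteq> UNIV" "K \<in> borel_measurable (lebesgue_on (ball 0 1))"
         "\<forall>y\<in>ball 0 1. lam \<le> K y \<and> K y \<le> Lam" "regular 1 Lam \<Omega> K"
         "u \<in> borel_measurable (lebesgue_on (B1 \<Omega>))" "Linf (B1 \<Omega>) u < \<infinity>" "Dini_loc \<Omega> u"
         "wnorm 1 1 \<Omega> (LK K u) < \<infinity>" for \<Omega> :: "'a set" and K u :: "'a \<Rightarrow> real"
  proof -
    obtain m where m: "0 \<le> m" "e2ennreal (Linf (B1 \<Omega>) u) = ennreal m" "AE x in lebesgue_on (B1 \<Omega>). \<bar>u x\<bar> \<le> m"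
      using Linf_bound[OF h(8)] by blast
    define F where "F = enn2real (wnorm 1 1 \<Omega> (LK K u))"
    have F: "0 \<le> F" "wnorm 1 1 \<Omega> (LK K u) = ennreal F" using h(10) by (auto simp: F_def)
    note est = increment_bound[OF assms h(1-7) m(1,3) h(9) F(1) eq_refl[OF F(2)],
        folded \<sigma>_def, folded c1_def, folded c2_def]
    \<comment> \<open>The 2 secures 2m <= A for distant pairs; one further unit accounts for the sup
      norm.\<close>
    define A where "A = (c2 + 2) * (m + F)"
    have A: "0 \<le> A" "2 * m \<le> A" "m + A \<le> (\<bar>c2\<bar> + 3) * (m + F)"
      using est(1) m(1) F(1) mult_nonneg_nonneg[of c2 "m + F"] by (auto simp: A_def algebra_simps)
    have "\<bar>u x - u y\<bar> \<le> A * (ell (dist x y) / ell (dB2 \<Omega> x y))\<^sup>2"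
      if "x \<in> \<Omega>" "y \<in> \<Omega>" "x \<noteq> y" for x y
      by (rule order_trans[OF est(3)[OF that]]) (use m(1) F(1) in \<open>auto simp: A_def intro!: mult_right_mono\<close>)
    then have w: "wnorm 0 (1 + 1/2) \<Omega> u \<le> ennreal (m + A)"
      using est(2) m(1) A by (intro wnorm_le h) auto
    have "ennreal (m + A) \<le> ennreal ((\<bar>c2\<bar> + 3) * (m + F))" by (intro ennreal_leI A)
    also have "\<dots> = ennreal (\<bar>c2\<bar> + 3) * (e2ennreal (Linf (B1 \<Omega>) u) + wnorm 1 1 \<Omega> (LK K u))"
      unfolding m(2) F(2) using m(1) F(1) by (simp add: ennreal_mult)
    finally have "wnorm 0 (1 + 1/2) \<Omega> u \<le> ennreal (\<bar>c2\<bar> + 3) * (e2ennreal (Linf (B1 \<Omega>) u) + wnorm 1 1 \<Omega> (LK K u))"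
      using w by (rule order_trans[rotated])
    moreover have "Lloc (1 + 1/2) \<Omega> u"
      using m(1) A(1) by (intro Lloc_of_wnorm[OF h(1-3) _ Dini_loc_continuous[OF h(1,9)] est(2) w]) auto
    ultimately show ?thesis by blast
  qed
  have "\<exists>C::real. C > 0 \<and>
      (\<forall>(\<Omega>::'a set) (K::'a \<Rightarrow> real) (u::'a \<Rightarrow> real).
         open \<Omega> \<and> \<Omega> \<noteq> {} \<and> \<Omega> \<noteq> UNIV
         \<and> bdd_above (dB \<Omega> ` \<Omega>) \<and> (SUP x\<in>\<Omega>. dB \<Omega> x) = R
         \<and> K \<in> borel_measurable (lebesgue_on (ball 0 1))
         \<and> (\<forall>y\<in>ball 0 1. lam \<le> K y \<and> K y \<le> Lam)
         \<and> regular 1 Lam \<Omega> K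
         \<and> u \<in> borel_measurable (lebesgue_on (B1 \<Omega>))
         \<and> Linf (B1 \<Omega>) u < \<infinity>
         \<and> Dini_loc \<Omega> u
         \<and> wnorm 1 1 \<Omega> (LK K u) < \<infinity>
         \<longrightarrow> Lloc (1 + 1/2) \<Omega> u
           \<and> wnorm 0 (1 + 1/2) \<Omega> u
               \<le> ennreal C * (e2ennreal (Linf (B1 \<Omega>) u) + wnorm 1 1 \<Omega> (LK K u)))" for R
    by (rule exI[of _ "\<bar>c2\<bar> + 3"]) (use main in auto)
  then show ?thesis by (intro exI[of _ "1/2"]) simp
qed

end
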